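(* Let $n\geqslant 4$. Every Cameron–Liebler line class in $PG(n,4)$ is one of the following line sets or the complement (in the set of all lines of $PG(n,4)$) of one of them: the set of all lines of $PG(n,4)$; the set of all lines contained in a hyperplane $H$; the set ${\rm Star}(P)$ of all lines through a point $P$; the set of all lines that pass through $P$ or are contained in $H$, for a point $P$ and a hyperplane $H$ with $P\notin H$.
   Context: Let $q$ be a prime power and $n\geqslant 3$. A set $\mathcal L$ of lines of $PG(n,q)$ is a Cameron–Liebler line class if there exists an integer $x$ such that for every line $l$, $$|\{m\in\mathcal L\setminus\{l\}: m \text{ meets } l\}| = (q+1)x+(q^{n-1}+q^{n-2}+\dots+q^2-1)\chi_{\mathcal L}(l),$$ where $\chi_{\mathcal L}$ is the characteristic function of $\mathcal L$. *)

theory Defs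
  imports "HOL-Analysis.Cartesian_Space"
begin

text \<open>
  \<open>PG(n,q)\<close> is modelled on the vector space \<open>'a^'n\<close> over a finite field \<open>'a\<close> with
  \<open>q = CARD('a)\<close> and \<open>n = CARD('n) - 1\<close>. A projective subspace of projective dimension \<open>d\<close> is a
  linear subspace of dimension \<open>d + 1\<close>, and incidence is inclusion.
\<close>

definition pg_dim :: "'n::finite itself \<Rightarrow> nat"
  where "pg_dim _ = CARD('n) - 1"

definition pg_subspaces :: "nat \<Rightarrow> ('a::{field,finite}^'n::finite) set set"
  where "pg_subspaces d = {U. vec.subspace U \<and> vec.dim U = d + 1}"

definition pg_points :: "('a::{field,finite}^'n::finite) set set"
  where "pg_points = pg_subspaces 0"

definition pg_lines :: "('a::{field,finite}^'n::finite) set set"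
  where "pg_lines = pg_subspaces 1"

definition pg_hyperplanes :: "('a::{field,finite}^'n::finite) set set"
  where "pg_hyperplanes = {H. vec.subspace H \<and> vec.dim H = pg_dim TYPE('n)}"

definition meets :: "('a::{field,finite}^'n::finite) set \<Rightarrow> ('a^'n) set \<Rightarrow> bool"
  where "meets m l \<longleftrightarrow> (\<exists>P\<in>pg_points. P \<subseteq> m \<and> P \<subseteq> l)"

definition star :: "('a::{field,finite}^'n::finite) set \<Rightarrow> ('a^'n) set set"
  where "star P = {l \<in> pg_lines. P \<subseteq> l}"

definition lines_in :: "('a::{field,finite}^'n::finite) set \<Rightarrow> ('a^'n) set set"
  where "lines_in H = {l \<in> pg_lines. l \<subseteq> H}"

definition cameron_liebler :: "('a::{field,finite}^'n::finite) set set \<Rightarrow> bool"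
  where "cameron_liebler L \<longleftrightarrow> L \<subseteq> pg_lines \<and>
    (\<exists>x::int. \<forall>l\<in>pg_lines.
      int (card {m \<in> L - {l}. meets m l}) =
        (int CARD('a) + 1) * x +
        ((\<Sum>i = 2..pg_dim TYPE('n) - 1. int CARD('a) ^ i) - 1) * (if l \<in> L then 1 else 0))"

end

theory Submission
  imports Defs
begin

text \<open>
  If \<open>w(P)\<close> is the number of lines of the class on \<open>P\<close> minus the parameter \<open>x\<close>, then the sums of \<open>w\<close>
  along lines are proportional to the characteristic function of the class. A suitable normalisation,
  possibly after complementation, is an integer function \<open>f\<close> on the points all of whose line sums
  are 0 or 4. Counting in planes, solids and 4-spaces shows that the weight \<open>t\<close> (a quarter of the
  sum of \<open>f\<close>) satisfies \<open>N \<Sigma> f\<^sup>2 = 4 t (4 N + 1 - t)\<close> with \<open>N = 1, 5, 21\<close> respectively. Summing weights and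
  these quadratic expressions over the five solids on a plane of a 4-space leaves so few
  possibilities for the weights of the planes that \<open>\<Sigma> f\<^sup>2\<close> on a line, and then the value of
  \<open>f\<close> at a point, are determined; unless \<open>f\<close> takes only the values 0 and 1, or one of the values 4 and
  \<open>-3\<close>, the result contradicts the line sums modulo 4. The exceptional cases are the known examples.
\<close>

section \<open>Pencils of subspaces\<close>

text \<open>For subspaces \<open>W\<close> \<subseteq> \<open>U\<close> these are the points of the
  quotient space of \<open>U\<close> by \<open>W\<close>: the lines on a point, the planes on a
  line, the solids on a plane.\<close>

definition pencil :: "('a::{field,finite}^'n::finite) set \<Rightarrow> ('a^'n) set \<Rightarrow> ('a^'n) set set"
  where "pencil W U = {X. vec.subspace X \<and> W \<subseteq> X \<and> X \<subseteq> U \<and> vec.dim X = vec.dim W + 1}"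

lemma dim_span_insert:
  fixes W :: "('a::{field,finite}^'n::finite) set"
  assumes "vec.subspace W" "v \<notin> W"
  shows "vec.dim (vec.span (insert v W)) = vec.dim W + 1"
proof -
  have "v \<notin> vec.span W"
    using assms vec.span_eq_iff by blast
  then show ?thesis
    by (simp add: vec.dim_insert)
qed

lemma card_subspace:
  fixes U :: "('a::{field,finite}^'n::finite) set"
  assumes "vec.subspace U"
  shows "card U = CARD('a) ^ vec.dim U"
proof -
  have "card (vec.span B) = CARD('a) ^ card B" if "vec.independent B" for B :: "('a^'n) set"
    using finite[of B] that
  proof (induction B rule: finite_induct)
    case empty
    show ?case by (simp add: vec.span_empty)
  next
    case (insert b B)
    then have b: "b \<notin> vec.span B" and ind: "vec.independent B"
      by (auto simp: vec.independent_insert)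
    \<comment> \<open>Every vector of the larger span is uniquely a multiple of \<open>b\<close>
      plus a vector of the smaller one, so the cardinality is multiplied by the field size.\<close>
    let ?h = "\<lambda>(c, w). c *s b + w"
    have "bij_betw ?h (UNIV \<times> vec.span B) (vec.span (insert b B))"
      unfolding bij_betw_def
    proof
      show "inj_on ?h (UNIV \<times> vec.span B)"
      proof (rule inj_onI, clarify)
        fix c d v w assume vw: "v \<in> vec.span B" "w \<in> vec.span B" and eq: "c *s b + v = d *s b + w"
        have "(c - d) *s b = w - v"
          using eq by (simp add: vec.scale_left_diff_distrib algebra_simps)
        then have "(c - d) *s b \<in> vec.span B"
          using vw by (simp add: vec.span_diff)
        then have "c = d"
          using b vec.span_scale[of "(c - d) *s b" B "inverse (c - d)"] by (cases "c = d") auto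
        then show "c = d \<and> v = w" using eq by simp
      qed
      show "?h ` (UNIV \<times> vec.span B) = vec.span (insert b B)"
      proof (intro equalityI subsetI)
        fix x assume "x \<in> ?h ` (UNIV \<times> vec.span B)"
        then show "x \<in> vec.span (insert b B)"
          by (auto intro!: vec.span_add vec.span_scale intro: vec.span_base
              vec.span_mono[THEN subsetD, of B "insert b B"])
      next
        fix x assume "x \<in> vec.span (insert b B)"
        then obtain k where "x - k *s b \<in> vec.span B"
          by (auto simp: vec.span_breakdown_eq)
        then show "x \<in> ?h ` (UNIV \<times> vec.span B)"
          by (intro image_eqI[of _ _ "(k, x - k *s b)"]) auto
      qed
    qed
    then have "card (vec.span (insert b B)) = card ((UNIV :: 'a set) \<times> vec.span B)"
      using bij_betw_same_card by metis
    then show ?case using insert ind by (simp add: card_cartesian_product)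
  qed
  moreover obtain B where "B \<subseteq> U" "vec.independent B" "U \<subseteq> vec.span B" "card B = vec.dim U"
    using vec.basis_exists by blast
  ultimately show ?thesis
    using assms by (metis vec.span_subspace)
qed

lemma pencil_eq_span:
  assumes "vec.subspace W" "X \<in> pencil W U" "v \<in> X - W"
  shows "X = vec.span (insert v W)"
proof -
  have "vec.span (insert v W) \<subseteq> X"
    using assms by (intro vec.span_minimal) (auto simp: pencil_def)
  moreover have "vec.dim (vec.span (insert v W)) = vec.dim X"
    using assms dim_span_insert[of W v] by (simp add: pencil_def)
  moreover have "vec.subspace X"
    using assms by (simp add: pencil_def)
  ultimately show ?thesis
    using vec.subspace_dim_equal[of "vec.span (insert v W)" X] by simp
qed

lemma span_insert_in_pencil:
  assumes "vec.subspace W" "vec.subspace U" "W \<subseteq> U" "v \<in> U - W"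
  shows "vec.span (insert v W) \<in> pencil W U"
proof -
  have "vec.span (insert v W) \<subseteq> U"
    using assms by (intro vec.span_minimal) auto
  then show ?thesis
    using assms dim_span_insert[of W v] vec.span_superset[of "insert v W"] by (auto simp: pencil_def)
qed

text \<open>Each vector of \<open>U - W\<close> lies in exactly one member, its span with
  \<open>W\<close>. So the sets \<open>X - W\<close> partition \<open>U - W\<close>, while
  \<open>W\<close> is counted once per member. All averaging arguments below rest on this.\<close>

lemma sum_pencil:
  fixes g :: "('a::{field,finite}^'n::finite) \<Rightarrow> int"
  assumes "vec.subspace W" "vec.subspace U" "W \<subseteq> U"
  shows "(\<Sum>X\<in>pencil W U. sum g X) = int (card (pencil W U)) * sum g W + (sum g U - sum g W)"
proof -
  have "U - W = (\<Union>X\<in>pencil W U. X - W)"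
  proof (intro equalityI subsetI)
    fix v assume "v \<in> U - W"
    then show "v \<in> (\<Union>X\<in>pencil W U. X - W)"
      using span_insert_in_pencil[OF assms] vec.span_base[of v "insert v W"] by auto
  qed (auto simp: pencil_def)
  moreover have "(X - W) \<inter> (Y - W) = {}"
    if "X \<in> pencil W U" "Y \<in> pencil W U" "X \<noteq> Y" for X Y
    using pencil_eq_span[OF assms(1) that(1)] pencil_eq_span[OF assms(1) that(2)] that(3) by blast
  ultimately have "sum g (U - W) = (\<Sum>X\<in>pencil W U. sum g (X - W))"
    using sum.UNION_disjoint[of "pencil W U" "\<lambda>X. X - W" g] by simp
  moreover have "sum g (X - W) = sum g X - sum g W" if "X \<in> pencil W U" for X
    using that sum_diff[of X W g] by (simp add: pencil_def)
  ultimately have "sum g (U - W) = (\<Sum>X\<in>pencil W U. sum g X - sum g W)"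
    by simp
  then show ?thesis
    using assms(3) sum_diff[of U W g] by (simp add: sum_subtractf)
qed

text \<open>The same partition with \<open>g\<close> = 1, in a form that avoids integer
  division.\<close>

lemma card_pencil:
  fixes W U :: "('a::{field,finite}^'n::finite) set"
  assumes "vec.subspace W" "vec.subspace U" "W \<subseteq> U"
  shows "int (card (pencil W U)) * (int CARD('a) ^ (vec.dim W + 1) - int CARD('a) ^ vec.dim W)
    = int CARD('a) ^ vec.dim U - int CARD('a) ^ vec.dim W"
proof -
  have card: "(\<Sum>x\<in>X. 1) = int CARD('a) ^ vec.dim X" if "vec.subspace X" for X :: "('a^'n) set"
    using card_subspace[OF that] by simp
  have "(\<Sum>X\<in>pencil W U. \<Sum>x\<in>X. 1) = (\<Sum>X\<in>pencil W U. int CARD('a) ^ (vec.dim W + 1))"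
  proof (rule sum.cong[OF refl])
    fix X assume "X \<in> pencil W U"
    then show "(\<Sum>x\<in>X. 1) = int CARD('a) ^ (vec.dim W + 1)"
      unfolding pencil_def using card[of X] by fastforce
  qed
  also have "\<dots> = int (card (pencil W U)) * int CARD('a) ^ (vec.dim W + 1)"
    by (rule sum_constant)
  finally show ?thesis
    using sum_pencil[OF assms, of "\<lambda>_. 1"]
    unfolding right_diff_distrib card[OF assms(1)] card[OF assms(2)] by linarith
qed

lemma ex_subspace_between:
  fixes W U :: "('a::{field,finite}^'n::finite) set"
  assumes "vec.subspace W" "vec.subspace U" "W \<subseteq> U" "vec.dim W \<le> d" "d \<le> vec.dim U"
  shows "\<exists>X. vec.subspace X \<and> W \<subseteq> X \<and> X \<subseteq> U \<and> vec.dim X = d"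
  using assms(4,5)
proof (induction d rule: dec_induct)
  case base
  show ?case using assms by blast
next
  case (step d)
  then obtain X where X: "vec.subspace X" "W \<subseteq> X" "X \<subseteq> U" "vec.dim X = d"
    using Suc_leD by blast
  then have "X \<noteq> U" using step(4) by auto
  then obtain v where "v \<in> U - X" using X(3) by blast
  then have "vec.span (insert v X) \<in> pencil X U"
    using X assms(2) by (intro span_insert_in_pencil) auto
  then have "vec.subspace (vec.span (insert v X)) \<and> W \<subseteq> vec.span (insert v X)
      \<and> vec.span (insert v X) \<subseteq> U \<and> vec.dim (vec.span (insert v X)) = Suc d"
    using X unfolding pencil_def by auto
  then show ?case by blast
qed

lemma ex_nonzero:
  fixes U :: "('a::{field,finite}^'n::finite) set"
  assumes "vec.subspace U" "vec.dim U > 0"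
  shows "\<exists>u\<in>U. u \<noteq> 0"
proof (rule ccontr)
  assume "\<not> ?thesis"
  then have "vec.dim U \<le> vec.dim {0 :: 'a^'n}"
    by (intro vec.dim_subset) auto
  also have "vec.dim {0 :: 'a^'n} = 0"
    by (rule vec.dim_eq_0[THEN iffD2]) simp
  finally show False using assms(2) by linarith
qed

lemma ex_plane:
  fixes u v :: "'a::{field,finite}^'n::finite"
  assumes "CARD('n) \<ge> 3"
  obtains P where "vec.subspace P" "vec.dim P = 3" "u \<in> P" "v \<in> P"
proof -
  have "card {u, v} \<le> 2"
    by (simp add: card_insert_if)
  then have dim: "vec.dim (vec.span {u, v}) \<le> 3"
    using vec.dim_le_card[of "{u, v}" "{u, v}"] vec.span_superset[of "{u, v}"] by simp
  have "\<exists>P. vec.subspace P \<and> vec.span {u, v} \<subseteq> P \<and> P \<subseteq> UNIV \<and> vec.dim P = 3"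
  proof (rule ex_subspace_between[OF vec.subspace_span vec.subspace_UNIV subset_UNIV dim])
    show "3 \<le> vec.dim (UNIV :: ('a^'n) set)" unfolding vec_dim_card by (rule assms(1))
  qed
  then obtain P where "vec.subspace P" "vec.dim P = 3" "vec.span {u, v} \<subseteq> P"
    by blast
  moreover have "u \<in> vec.span {u, v}" "v \<in> vec.span {u, v}"
    by (auto intro: vec.span_base)
  ultimately show ?thesis
    using that by blast
qed

section \<open>Lines of a subspace and incident point-line pairs\<close>

definition lines_within :: "('a::{field,finite}^'n::finite) set \<Rightarrow> ('a^'n) set set"
  where "lines_within U = {l. vec.subspace l \<and> vec.dim l = 2 \<and> l \<subseteq> U}"

lemma subspace_point: "vec.subspace (vec.span {u})"
  by simp

lemma dim_point: "u \<noteq> 0 \<Longrightarrow> vec.dim (vec.span {u}) = 1"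
  by simp

lemma point_subset_iff: "vec.subspace U \<Longrightarrow> vec.span {u} \<subseteq> U \<longleftrightarrow> u \<in> U"
  using vec.span_minimal[of "{u}" U] vec.span_base[of u "{u}"] by blast

lemma pencil_point:
  assumes "u \<noteq> 0"
  shows "pencil (vec.span {u}) U = {l \<in> lines_within U. u \<in> l}"
  using assms point_subset_iff[of _ u] by (auto simp: pencil_def lines_within_def)

lemma sum_flags:
  fixes h :: "'a::{field,finite}^'n::finite \<Rightarrow> ('a^'n) set \<Rightarrow> int"
  shows "(\<Sum>u\<in>U - {0}. \<Sum>l\<in>pencil (vec.span {u}) U. h u l) = (\<Sum>l\<in>lines_within U. \<Sum>u\<in>l - {0}. h u l)"
proof -
  have "(\<Sum>u\<in>U - {0}. \<Sum>l\<in>pencil (vec.span {u}) U. h u l)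
      = (\<Sum>u\<in>U - {0}. \<Sum>l | l \<in> lines_within U \<and> u \<in> l. h u l)"
    by (intro sum.cong refl) (simp add: pencil_point)
  also have "\<dots> = (\<Sum>l\<in>lines_within U. \<Sum>u | u \<in> U - {0} \<and> u \<in> l. h u l)"
    by (rule sum.swap_restrict) auto
  also have "\<dots> = (\<Sum>l\<in>lines_within U. \<Sum>u\<in>l - {0}. h u l)"
    by (intro sum.cong refl) (auto simp: lines_within_def)
  finally show ?thesis .
qed

lemma sum_scale_invariant_point:
  fixes g :: "('a::{field,finite}^'n::finite) \<Rightarrow> int"
  assumes "g 0 = 0" "\<And>c v. c \<noteq> 0 \<Longrightarrow> g (c *s v) = g v" "u \<noteq> 0"
  shows "sum g (vec.span {u}) = (int CARD('a) - 1) * g u"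
proof -
  have inj: "inj (\<lambda>c. c *s u)"
    using assms(3) by (auto simp: inj_def vec_eq_iff)
  have "sum g (vec.span {u}) = (\<Sum>c\<in>UNIV. g (c *s u))"
    using sum.reindex[OF inj, of g] by (simp add: vec.span_singleton)
  also have "\<dots> = (\<Sum>c\<in>(UNIV :: 'a set). if c = 0 then 0 else g u)"
    by (rule sum.cong) (auto simp: assms)
  also have "\<dots> = (int CARD('a) - 1) * g u"
    by (simp add: sum.If_cases Compl_eq_Diff_UNIV card_Diff_subset of_nat_diff Suc_leI)
  finally show ?thesis .
qed

lemma sum_remove_zero:
  fixes g :: "('a::{field,finite}^'n::finite) \<Rightarrow> int"
  assumes "vec.subspace U" "g 0 = 0"
  shows "sum g (U - {0}) = sum g U"
  using assms sum.remove[of U 0 g] vec.subspace_0[of U] by simp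

section \<open>Functions with two line sums\<close>

text \<open>
  A function on the points is modelled as a function on the vectors that is constant on the three
  nonzero multiples of a vector; hence every sum over points appears below multiplied by 3.
\<close>

locale two_valued =
  fixes f :: "('a::{field,finite}^'n::finite) \<Rightarrow> int" and s :: int
  assumes card_field: "CARD('a) = 4"
    and f_zero [simp]: "f 0 = 0"
    and f_scale: "\<And>c v. c \<noteq> 0 \<Longrightarrow> f (c *s v) = f v"
    and line_sum: "\<And>l. vec.subspace l \<Longrightarrow> vec.dim l = 2 \<Longrightarrow> sum f l = 0 \<or> sum f l = 3 * s"
begin

definition degree :: "'a^'n \<Rightarrow> ('a^'n) set \<Rightarrow> int"
  where "degree u U = int (card {l \<in> pencil (vec.span {u}) U. sum f l = 3 * s})"

lemma sum_point: "u \<noteq> 0 \<Longrightarrow> sum f (vec.span {u}) = 3 * f u"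
  using sum_scale_invariant_point[of f u] by (simp add: f_scale card_field)

lemma sum_sq_point: "u \<noteq> 0 \<Longrightarrow> (\<Sum>v\<in>vec.span {u}. (f v)\<^sup>2) = 3 * (f u)\<^sup>2"
  using sum_scale_invariant_point[of "\<lambda>v. (f v)\<^sup>2" u] by (simp add: f_scale card_field)

lemma card_pencil_4:
  fixes W U :: "('a^'n) set"
  assumes "vec.subspace W" "vec.subspace U" "W \<subseteq> U"
  shows "int (card (pencil W U)) * (3 * 4 ^ vec.dim W) = 4 ^ vec.dim U - 4 ^ vec.dim W"
  using card_pencil[OF assms] by (simp add: card_field)

text \<open>The hypothesis on \<open>N\<close> is a division-free form of \<open>N\<close> = (4^(dim
  \<open>U\<close> - 1) - 1)/3; it gives 5, 21 and 85 lines on a point of a plane, a solid and a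
  4-space.\<close>

lemma card_pencil_point:
  fixes U :: "('a^'n) set"
  assumes "vec.subspace U" "u \<in> U" "u \<noteq> 0" "12 * N + 4 = 4 ^ vec.dim U"
  shows "int (card (pencil (vec.span {u}) U)) = N"
  using card_pencil_4[of "vec.span {u}" U] assms by (simp add: point_subset_iff)

lemma degree_bounds:
  assumes "vec.subspace U" "u \<in> U" "u \<noteq> 0" "12 * N + 4 = 4 ^ vec.dim U"
  shows "0 \<le> degree u U" "degree u U \<le> N"
proof -
  have "card {l \<in> pencil (vec.span {u}) U. sum f l = 3 * s} \<le> card (pencil (vec.span {u}) U)"
    by (rule card_mono) auto
  then show "degree u U \<le> N"
    using card_pencil_point[OF assms] by (simp add: degree_def)
qed (simp add: degree_def)

text \<open>Add the sums of the \<open>N\<close> lines of \<open>U\<close> on \<open>u\<close>: the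
  point itself is counted \<open>N\<close> times, every other point once.\<close>

lemma sum_degree:
  assumes "vec.subspace U" "u \<in> U" "u \<noteq> 0" "12 * N + 4 = 4 ^ vec.dim U"
  shows "sum f U + 3 * (N - 1) * f u = 3 * s * degree u U"
proof -
  have "(\<Sum>l\<in>pencil (vec.span {u}) U. sum f l)
      = (\<Sum>l\<in>pencil (vec.span {u}) U. if sum f l = 3 * s then 3 * s else 0)"
    using line_sum by (intro sum.cong refl) (fastforce simp: pencil_point[OF assms(3)] lines_within_def)
  also have "\<dots> = 3 * s * degree u U"
    by (simp add: sum.If_cases degree_def Int_def)
  finally show ?thesis
    using sum_pencil[of "vec.span {u}" U f] assms card_pencil_point[OF assms]
    by (simp add: point_subset_iff sum_point algebra_simps)
qed

text \<open>Every line satisfies \<open>sum f l * (sum f l - 3 * s) = 0\<close>. Adding this over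
  all lines of \<open>U\<close> and regrouping by points, with factor \<open>f u\<close>, gives a
  relation between the sum of \<open>f\<close> and its sum of squares.\<close>

lemma sum_quadratic:
  assumes U: "vec.subspace U" and N: "12 * N + 4 = 4 ^ vec.dim U"
  shows "(sum f U)\<^sup>2 + 3 * (N - 1) * (\<Sum>v\<in>U. (f v)\<^sup>2) = 3 * s * N * sum f U"
proof -
  have "(\<Sum>l\<in>lines_within U. \<Sum>u\<in>l - {0}. f u * (sum f l - 3 * s)) = 0"
  proof (rule sum.neutral, rule ballI)
    fix l assume "l \<in> lines_within U"
    then have "vec.subspace l" "sum f l = 0 \<or> sum f l = 3 * s"
      using line_sum by (auto simp: lines_within_def)
    then show "(\<Sum>u\<in>l - {0}. f u * (sum f l - 3 * s)) = 0"
      using sum_remove_zero[of l f] by (auto simp: sum_distrib_right[symmetric])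
  qed
  then have "0 = (\<Sum>u\<in>U - {0}. \<Sum>l\<in>pencil (vec.span {u}) U. f u * (sum f l - 3 * s))"
    by (simp only: sum_flags)
  also have "\<dots> = (\<Sum>u\<in>U - {0}. (sum f U - 3 * s * N) * f u + 3 * (N - 1) * (f u)\<^sup>2)"
  proof (rule sum.cong[OF refl])
    fix u assume u: "u \<in> U - {0}"
    have "(\<Sum>l\<in>pencil (vec.span {u}) U. f u * (sum f l - 3 * s))
        = f u * ((\<Sum>l\<in>pencil (vec.span {u}) U. sum f l) - N * (3 * s))"
      using card_pencil_point[of U u N] U N u
      by (simp add: sum_distrib_left[symmetric] sum_subtractf)
    also have "\<dots> = f u * (N * (3 * f u) + (sum f U - 3 * f u) - N * (3 * s))"
      using sum_pencil[of "vec.span {u}" U f] card_pencil_point[of U u N] U N u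
      by (simp add: point_subset_iff sum_point)
    finally show "(\<Sum>l\<in>pencil (vec.span {u}) U. f u * (sum f l - 3 * s))
        = (sum f U - 3 * s * N) * f u + 3 * (N - 1) * (f u)\<^sup>2"
      by (simp add: algebra_simps power2_eq_square)
  qed
  also have "\<dots> = (sum f U - 3 * s * N) * sum f (U - {0}) + 3 * (N - 1) * (\<Sum>u\<in>U - {0}. (f u)\<^sup>2)"
    by (simp add: sum.distrib sum_distrib_left)
  also have "\<dots> = (sum f U - 3 * s * N) * sum f U + 3 * (N - 1) * (\<Sum>u\<in>U. (f u)\<^sup>2)"
    using U by (simp add: sum_remove_zero)
  finally show ?thesis
    by (simp add: algebra_simps power2_eq_square)
qed

end

section \<open>Weights of planes and solids\<close>

text \<open>\<open>c\<close> is the multiplicity of the head entry in a multiset of \<open>n\<close>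
  entries. The test \<open>int c * b \<le> d\<close> keeps the evaluation small and loses nothing
  when all second coordinates are nonnegative.\<close>

fun reachable :: "(int \<times> int) list \<Rightarrow> nat \<Rightarrow> int \<Rightarrow> int \<Rightarrow> bool" where
  "reachable [] n s d \<longleftrightarrow> n = 0 \<and> s = 0 \<and> d = 0"
| "reachable ((a, b) # vs) n s d \<longleftrightarrow>
    list_ex (\<lambda>c. int c * b \<le> d \<and> reachable vs (n - c) (s - int c * a) (d - int c * b)) [0..<Suc n]"

text \<open>The elements of \<open>A\<close> whose pair is the head of the list supply the
  multiplicity; the others go to the tail by induction. Nonnegative second coordinates make the
  pruning test succeed.\<close>

lemma reachable_sum:
  fixes t d :: "'b \<Rightarrow> int"
  assumes "finite A" "\<And>x. x \<in> A \<Longrightarrow> (t x, d x) \<in> set vs" "\<forall>(a, b) \<in> set vs. b \<ge> 0"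
  shows "reachable vs (card A) (sum t A) (sum d A)"
  using assms
proof (induction vs arbitrary: A)
  case Nil
  then have "A = {}" by auto
  then show ?case by simp
next
  case (Cons v vs)
  obtain a b where v: "v = (a, b)" by fastforce
  define B where "B = {x \<in> A. (t x, d x) = v}"
  have fin: "finite B" "B \<subseteq> A" "finite (A - B)" using Cons.prems(1) by (auto simp: B_def)
  have "reachable vs (card (A - B)) (sum t (A - B)) (sum d (A - B))"
    using Cons.prems fin by (intro Cons.IH) (auto simp: B_def)
  moreover have "sum t B = int (card B) * a" "sum d B = int (card B) * b"
    by (simp_all add: B_def v)
  moreover have "sum d (A - B) \<ge> 0"
    using Cons.prems(2,3) by (intro sum_nonneg) force
  ultimately show ?case
    using fin Cons.prems(1) card_mono[OF Cons.prems(1) fin(2)]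
    by (auto simp: v list_ex_iff sum_diff card_Diff_subset intro!: bexI[of _ "card B"])
qed

text \<open>
  The possible pairs \<open>(t, 11 - t(21 - t)/10)\<close> for a solid of weight \<open>t\<close>; \<open>10\<close> divides \<open>t(21 - t)\<close>.
\<close>

definition solid_pairs :: "(int \<times> int) list"
  where "solid_pairs = [(1, 9), (5, 3), (6, 2), (10, 0), (11, 0), (15, 2), (16, 3), (20, 9), (21, 11)]"

lemma plane_weight_cases:
  assumes "reachable (if k = 0 then (0, 11) # solid_pairs else solid_pairs) 5
      (t + 4 * k) (55 - (m + 2 * k * (5 - k)))"
    and "(t, m) \<in> set [(21, 32), (22, 33), (28, 38), (36, 42), (42, 43), (43, 43)]"
    and "0 \<le> k" "k \<le> 4"
  shows "k \<in> set (if t \<le> 22 then [1, 2] else if t \<le> 36 then [0, 4] else if t = 42 then [0, 2, 3] else [2, 3])"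
proof -
  have "list_all (\<lambda>(t, m). list_all (\<lambda>k :: int.
      reachable (if k = 0 then (0, 11) # solid_pairs else solid_pairs) 5
        (t + 4 * k) (55 - (m + 2 * k * (5 - k))) \<longrightarrow>
      k \<in> set (if t \<le> 22 then [1, 2] else if t \<le> 36 then [0, 4] else if t = 42 then [0, 2, 3] else [2, 3]))
      [0, 1, 2, 3, 4]) [(21, 32), (22, 33), (28, 38), (36, 42), (42, 43), (43, 43)]"
    by code_simp
  moreover have "k \<in> set [0, 1, 2, 3, 4]"
    using assms(3,4) by auto
  ultimately show ?thesis
    using assms(1,2) unfolding list_all_iff by blast
qed

text \<open>Divisibility by 42 leaves few weights. Those below 21 and the four largest yield to
  degree bounds or sums of squares; the six in between need the search over solids.\<close>

lemma weight_cases: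
  assumes "0 \<le> t" "t \<le> 64" "42 * m = t * (85 - t)"
  shows "t < 21 \<or> (t, m) \<in> set [(21, 32), (22, 33), (28, 38), (36, 42), (42, 43), (43, 43)]
    \<or> t \<in> {49, 57, 63, 64 :: int}"
proof -
  have "list_all (\<lambda>t. t * (85 - t) mod 42 = 0 \<longrightarrow> t < 21 \<or>
      (t, t * (85 - t) div 42) \<in> set [(21, 32), (22, 33), (28, 38), (36, 42), (42, 43), (43, 43)]
      \<or> t \<in> set [49, 57, 63, 64 :: int]) [0..64]"
    by code_simp
  moreover have "t * (85 - t) mod 42 = 0" "m = t * (85 - t) div 42"
    by (simp_all flip: assms(3))
  ultimately show ?thesis
    using assms(1,2) by (simp add: list_all_iff)
qed

text \<open>5 divides \<open>t * (21 - t)\<close>, so \<open>t\<close> is 0 or 1 modulo 5. The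
  largest \<open>S\<close> is 264 = 24 * 11, at \<open>t\<close> = 10 and 11; the second entry is
  the shortfall from it in units of 24.\<close>

lemma solid_weight_cases:
  assumes "0 \<le> t" "t \<le> 21" "5 * S = 12 * t * (21 - t)"
  shows "(t, 264 - S) \<in> (\<lambda>(t, d). (t, 24 * d)) ` set ((0, 11) # solid_pairs)"
proof -
  have "list_all (\<lambda>t. 12 * t * (21 - t) mod 5 = 0 \<longrightarrow>
      (t, 264 - 12 * t * (21 - t) div 5) \<in> set (map (\<lambda>(t, d). (t, 24 * d)) ((0, 11) # solid_pairs))) [0..21]"
    by code_simp
  moreover have "12 * t * (21 - t) mod 5 = 0" "S = 12 * t * (21 - t) div 5"
    by (simp_all flip: assms(3))
  ultimately show ?thesis
    using assms(1,2) by (simp add: list_all_iff)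
qed

lemma int_le_square: "(x :: int) \<le> x\<^sup>2"
  using self_le_power[of x 2] zero_le_power2[of x] by linarith

section \<open>Weights and sums of squares for line sums 0 and 4\<close>

locale four_valued = two_valued f 4 for f :: "('a::{field,finite}^'n::finite) \<Rightarrow> int"
begin

definition weight :: "('a^'n) set \<Rightarrow> int"
  where "weight U = sum f U div 12"

definition sumsq :: "('a^'n) set \<Rightarrow> int"
  where "sumsq U = (\<Sum>v\<in>U. (f v)\<^sup>2)"

text \<open>Here a point of \<open>U\<close> is on \<open>4 * N + 1\<close> lines of
  \<open>U\<close>. The degree identity shows that 12 divides \<open>sum f U\<close>, so the
  division in \<open>weight\<close> is exact; 12 is 3 vectors per point times the line sum
  4.\<close>

lemma weight_degree:
  assumes "vec.subspace U" "vec.dim U > 0" "12 * (4 * N + 1) + 4 = 4 ^ vec.dim U"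
  shows "sum f U = 12 * weight U"
    and "\<And>u. u \<in> U \<Longrightarrow> u \<noteq> 0 \<Longrightarrow> degree u U = weight U + N * f u"
proof -
  have *: "sum f U + 12 * N * f u = 12 * degree u U" if "u \<in> U" "u \<noteq> 0" for u
    using sum_degree[OF assms(1) that assms(3)] by simp
  obtain u where "u \<in> U" "u \<noteq> 0" using ex_nonzero assms by blast
  then have "sum f U = 12 * (degree u U - N * f u)"
    using * by (simp add: algebra_simps)
  then show eq: "sum f U = 12 * weight U"
    by (simp add: weight_def)
  show "degree u U = weight U + N * f u" if "u \<in> U" "u \<noteq> 0" for u
    using *[OF that] eq by simp
qed

lemma sumsq_weight:
  assumes "vec.subspace U" "vec.dim U > 0" "12 * (4 * N + 1) + 4 = 4 ^ vec.dim U"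
  shows "N * sumsq U = 12 * weight U * (4 * N + 1 - weight U)"
proof -
  have "(12 * weight U)\<^sup>2 + 12 * N * sumsq U = 12 * (4 * N + 1) * (12 * weight U)"
    using sum_quadratic[OF assms(1,3)] weight_degree(1)[OF assms] by (simp add: sumsq_def)
  then have "12 * (N * sumsq U) = 12 * (12 * weight U * (4 * N + 1 - weight U))"
    by (simp add: algebra_simps power2_eq_square)
  then show ?thesis by simp
qed

lemma sum_le_sumsq: "sum f U \<le> sumsq U"
  unfolding sumsq_def by (intro sum_mono int_le_square)

lemma sumsq_eq_0: "sumsq U = 0 \<Longrightarrow> v \<in> U \<Longrightarrow> f v = 0"
  by (simp add: sumsq_def sum_nonneg_eq_0_iff)

lemma sumsq_eq_sum:
  assumes "sumsq U = sum f U" "v \<in> U"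
  shows "f v = 0 \<or> f v = 1"
proof -
  have nonneg: "(f v)\<^sup>2 - f v \<ge> 0" for v
    using int_le_square[of "f v"] by simp
  have "(\<Sum>v\<in>U. (f v)\<^sup>2 - f v) = 0"
    using assms by (simp add: sumsq_def sum_subtractf)
  then have "(f v)\<^sup>2 - f v = 0"
    using nonneg assms(2) sum_nonneg_eq_0_iff[of U "\<lambda>v. (f v)\<^sup>2 - f v"] by simp
  then show ?thesis by (simp add: power2_eq_square)
qed

text \<open>Integrality gives \<open>sum f P \<le> sumsq P\<close>, which confines the weight to
  0..4. At weight 0 the sum of squares vanishes; at weight 4 it equals the sum, which forces the
  values 0 and 1. The bounds on \<open>weight P + f u\<close> are those of a degree.\<close>

lemma plane_facts:
  assumes "vec.subspace P" "vec.dim P = 3"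
  shows "sum f P = 12 * weight P" "sumsq P = 12 * weight P * (5 - weight P)"
    and "0 \<le> weight P" "weight P \<le> 4"
    and "\<And>u. u \<in> P \<Longrightarrow> u \<noteq> 0 \<Longrightarrow> 0 \<le> weight P + f u \<and> weight P + f u \<le> 5"
    and "\<And>u. weight P = 0 \<Longrightarrow> u \<in> P \<Longrightarrow> f u = 0"
    and "\<And>u. weight P = 4 \<Longrightarrow> u \<in> P \<Longrightarrow> f u = 0 \<or> f u = 1"
proof -
  show F: "sum f P = 12 * weight P"
    using weight_degree(1)[of P 1] assms by simp
  show S: "sumsq P = 12 * weight P * (5 - weight P)"
    using sumsq_weight[of P 1] assms by simp
  have "weight P * (4 - weight P) \<ge> 0"
    using sum_le_sumsq[of P] unfolding F S by (simp add: algebra_simps)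
  then show "0 \<le> weight P" "weight P \<le> 4"
    by (auto simp: zero_le_mult_iff)
  show "0 \<le> weight P + f u \<and> weight P + f u \<le> 5" if "u \<in> P" "u \<noteq> 0" for u
    using weight_degree(2)[of P 1 u] degree_bounds[of P u 5] assms that by simp
  show "f u = 0" if "weight P = 0" "u \<in> P" for u
    using S that sumsq_eq_0 by simp
  show "f u = 0 \<or> f u = 1" if "weight P = 4" "u \<in> P" for u
    using S F that sumsq_eq_sum[of P u] by simp
qed

lemma solid_facts:
  assumes "vec.subspace X" "vec.dim X = 4"
  shows "sum f X = 12 * weight X" "5 * sumsq X = 12 * weight X * (21 - weight X)"
    and "0 \<le> weight X" "weight X \<le> 21"
    and "\<And>u. weight X = 0 \<Longrightarrow> u \<in> X \<Longrightarrow> f u = 0"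
proof -
  show F: "sum f X = 12 * weight X"
    using weight_degree(1)[of X 5] assms by simp
  show S: "5 * sumsq X = 12 * weight X * (21 - weight X)"
    using sumsq_weight[of X 5] assms by simp
  have "weight X * (21 - weight X) \<ge> 0"
    using S sum_nonneg[of X "\<lambda>v. (f v)\<^sup>2"] unfolding sumsq_def[symmetric] by simp
  then show "0 \<le> weight X" "weight X \<le> 21"
    by (auto simp: zero_le_mult_iff)
  show "f u = 0" if "weight X = 0" "u \<in> X" for u
    using S that sumsq_eq_0 by simp
qed

lemma sums_off_point:
  assumes "vec.subspace P" "u \<in> P" "u \<noteq> 0"
  shows "sum f (P - vec.span {u}) = sum f P - 3 * f u"
    and "(\<Sum>v\<in>P - vec.span {u}. (f v)\<^sup>2) = sumsq P - 3 * (f u)\<^sup>2"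
proof -
  have "vec.span {u} \<subseteq> P" using assms by (simp add: point_subset_iff)
  then show "sum f (P - vec.span {u}) = sum f P - 3 * f u"
    and "(\<Sum>v\<in>P - vec.span {u}. (f v)\<^sup>2) = sumsq P - 3 * (f u)\<^sup>2"
    using assms by (simp_all add: sum_diff sum_point sum_sq_point sumsq_def)
qed

text \<open>In a plane on \<open>u\<close> and \<open>v\<close> the degree bound forces weight 1 and
  \<open>f u = 4\<close>; the point \<open>u\<close> then uses up all of \<open>sumsq P\<close> =
  48.\<close>

lemma value_ge_4:
  assumes "CARD('n) \<ge> 3" "u \<noteq> 0" "f u \<ge> 4" "v \<notin> vec.span {u}"
  shows "f u = 4" "f v = 0"
proof -
  obtain P where P: "vec.subspace P" "vec.dim P = 3" "u \<in> P" "v \<in> P"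
    using ex_plane[OF assms(1)] by blast
  note facts = plane_facts[OF P(1,2)]
  have "weight P \<noteq> 0" using facts(6) P assms by force
  then have w: "weight P = 1" and u: "f u = 4"
    using facts(3) facts(5)[of u] P assms by force+
  show "f u = 4" by (fact u)
  have "(\<Sum>v\<in>P - vec.span {u}. (f v)\<^sup>2) = 0"
    using sums_off_point[of P u] P assms(2) facts(2) by (simp add: w u)
  then show "f v = 0"
    using P(4) assms(4) by (simp add: sum_nonneg_eq_0_iff)
qed

text \<open>A plane on \<open>u\<close> and \<open>v\<close> must have weight 3, with
  \<open>f u = -3\<close>. Off the point \<open>u\<close> the sum and the sum of squares are then
  both 45, so every value there is 0 or 1.\<close>

lemma value_le_minus_3:
  assumes "CARD('n) \<ge> 3" "u \<noteq> 0" "f u \<le> -3" "v \<notin> vec.span {u}"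
  shows "f u = -3" "f v = 0 \<or> f v = 1"
proof -
  obtain P where P: "vec.subspace P" "vec.dim P = 3" "u \<in> P" "v \<in> P"
    using ex_plane[OF assms(1)] by blast
  note facts = plane_facts[OF P(1,2)]
  have "weight P \<noteq> 4" using facts(7) P assms by force
  then have w: "weight P = 3" and u: "f u = -3"
    using facts(4) facts(5)[of u] P assms by force+
  show "f u = -3" by (fact u)
  have "(\<Sum>v\<in>P - vec.span {u}. (f v)\<^sup>2 - f v) = 0"
    using sums_off_point[of P u] P assms(2) facts(1,2) by (simp add: w u sum_subtractf)
  moreover have "(f v)\<^sup>2 - f v \<ge> 0" for v
    using int_le_square[of "f v"] by simp
  ultimately have "(f v)\<^sup>2 - f v = 0"
    using P(4) assms(4) sum_nonneg_eq_0_iff[of "P - vec.span {u}" "\<lambda>v. (f v)\<^sup>2 - f v"] by simp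
  then show "f v = 0 \<or> f v = 1" by (simp add: power2_eq_square)
qed

lemma space_facts:
  assumes "vec.subspace U" "vec.dim U = 5"
  shows "sum f U = 12 * weight U" "21 * sumsq U = 12 * weight U * (85 - weight U)"
    and "\<And>u. u \<in> U \<Longrightarrow> u \<noteq> 0 \<Longrightarrow> degree u U = weight U + 21 * f u"
    and "\<And>u. u \<in> U \<Longrightarrow> u \<noteq> 0 \<Longrightarrow> 0 \<le> weight U + 21 * f u \<and> weight U + 21 * f u \<le> 85"
    and "0 \<le> weight U" "weight U \<le> 64"
proof -
  show F: "sum f U = 12 * weight U"
    using weight_degree(1)[of U 21] assms by simp
  show S: "21 * sumsq U = 12 * weight U * (85 - weight U)"
    using sumsq_weight[of U 21] assms by simp
  have "weight U * (64 - weight U) \<ge> 0"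
    using sum_le_sumsq[of U] S unfolding F by (simp add: algebra_simps)
  then show "0 \<le> weight U" "weight U \<le> 64"
    by (auto simp: zero_le_mult_iff)
  show deg: "degree u U = weight U + 21 * f u" if "u \<in> U" "u \<noteq> 0" for u
    using weight_degree(2)[of U 21 u] assms that by simp
  show "0 \<le> weight U + 21 * f u \<and> weight U + 21 * f u \<le> 85" if "u \<in> U" "u \<noteq> 0" for u
    using deg[OF that] degree_bounds[of U u 85] assms that by simp
qed

section \<open>Averaging inside a 4-space\<close>

lemma sum_pencil_weights:
  assumes "vec.subspace W" "vec.subspace U" "W \<subseteq> U"
    and "int (card (pencil W U)) = N"
  shows "(\<Sum>X\<in>pencil W U. sum f X) = (N - 1) * sum f W + sum f U"
    and "(\<Sum>X\<in>pencil W U. sumsq X) = (N - 1) * sumsq W + sumsq U"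
  using sum_pencil[OF assms(1-3)] assms(4) by (simp_all add: sumsq_def algebra_simps)

text \<open>The weights of the five solids on \<open>P\<close> add up to
  \<open>weight U + 4 * weight P\<close>, and their sums of squares add up likewise. With squares
  replaced by shortfalls from 264, these totals are a target for \<open>reachable\<close>.\<close>

lemma solids_on_plane:
  assumes U: "vec.subspace U" "vec.dim U = 5"
    and P: "vec.subspace P" "vec.dim P = 3" "P \<subseteq> U"
  shows "\<exists>m. sumsq U = 24 * m \<and> 42 * m = weight U * (85 - weight U) \<and>
    reachable (if weight P = 0 then (0, 11) # solid_pairs else solid_pairs) 5
      (weight U + 4 * weight P) (55 - (m + 2 * weight P * (5 - weight P)))"
proof -
  define d where "d X = (264 - sumsq X) div 24" for X
  have solid: "(weight X, d X) \<in> set ((0, 11) # solid_pairs)" "24 * d X = 264 - sumsq X"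
    "sum f X = 12 * weight X" "weight P \<noteq> 0 \<longrightarrow> weight X \<noteq> 0" if "X \<in> pencil P U" for X
  proof -
    have X: "vec.subspace X" "vec.dim X = 4" "P \<subseteq> X"
      using that P by (auto simp: pencil_def)
    note facts = solid_facts[OF X(1,2)]
    have "(weight X, 264 - sumsq X) \<in> (\<lambda>(t, d). (t, 24 * d)) ` set ((0, 11) # solid_pairs)"
      using facts(2-4) by (intro solid_weight_cases) auto
    then obtain e where e: "(weight X, e) \<in> set ((0, 11) # solid_pairs)" "264 - sumsq X = 24 * e"
      by (force simp del: set_simps)
    then have "d X = e" by (simp add: d_def)
    then show "(weight X, d X) \<in> set ((0, 11) # solid_pairs)" "24 * d X = 264 - sumsq X"
      using e by auto
    show "sum f X = 12 * weight X" by (fact facts(1))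
    have "sum f P = 0" if "weight X = 0"
      using facts(5)[OF that] X(3) by (intro sum.neutral) auto
    then show "weight P \<noteq> 0 \<longrightarrow> weight X \<noteq> 0"
      using plane_facts(1)[OF P(1,2)] by auto
  qed
  have card: "card (pencil P U) = 5"
    using card_pencil_4[OF P(1) U(1) P(3)] U P by simp
  have "12 * (\<Sum>X\<in>pencil P U. weight X) = (\<Sum>X\<in>pencil P U. sum f X)"
    unfolding sum_distrib_left by (rule sum.cong) (auto simp: solid)
  also have "\<dots> = 4 * sum f P + sum f U"
    using sum_pencil_weights(1)[OF P(1) U(1) P(3), of 5] card by simp
  finally have t: "(\<Sum>X\<in>pencil P U. weight X) = weight U + 4 * weight P"
    using space_facts(1)[OF U] plane_facts(1)[OF P(1,2)] by simp
  have "24 * (\<Sum>X\<in>pencil P U. d X) = (\<Sum>X\<in>pencil P U. 264 - sumsq X)"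
    unfolding sum_distrib_left by (rule sum.cong) (auto simp: solid)
  also have "\<dots> = 1320 - (4 * sumsq P + sumsq U)"
    using sum_pencil_weights(2)[OF P(1) U(1) P(3), of 5] card by (simp add: sum_subtractf)
  finally have d: "24 * (\<Sum>X\<in>pencil P U. d X) = 1320 - (48 * weight P * (5 - weight P) + sumsq U)"
    using plane_facts(2)[OF P(1,2)] by simp
  \<comment> \<open>All shortfalls are integers, so this integer exhibits \<open>sumsq U\<close> as
    a multiple of 24.\<close>
  define m where "m = 55 - 2 * weight P * (5 - weight P) - (\<Sum>X\<in>pencil P U. d X)"
  have m: "sumsq U = 24 * m"
    using d by (simp add: m_def algebra_simps)
  moreover have "42 * m = weight U * (85 - weight U)"
    using space_facts(2)[OF U] m by simp
  moreover have "(weight X, d X) \<in> set (if weight P = 0 then (0, 11) # solid_pairs else solid_pairs)"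
    if "X \<in> pencil P U" for X
    using solid[OF that] by auto
  then have "reachable (if weight P = 0 then (0, 11) # solid_pairs else solid_pairs) (card (pencil P U))
      (\<Sum>X\<in>pencil P U. weight X) (\<Sum>X\<in>pencil P U. d X)"
    by (rule reachable_sum[OF finite]) (auto simp: solid_pairs_def)
  moreover have "(\<Sum>X\<in>pencil P U. d X) = 55 - (m + 2 * weight P * (5 - weight P))"
    by (simp add: m_def)
  ultimately show ?thesis
    unfolding t card by metis
qed

text \<open>Adds the affine relation over the 21 planes of \<open>U\<close> on
  \<open>l\<close>.\<close>

lemma planes_on_line:
  assumes U: "vec.subspace U" "vec.dim U = 5"
    and l: "l \<in> lines_within U"
    and affine: "\<And>P. vec.subspace P \<Longrightarrow> vec.dim P = 3 \<Longrightarrow> l \<subseteq> P \<Longrightarrow> P \<subseteq> U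
      \<Longrightarrow> sumsq P = \<alpha> * sum f P + \<beta>"
  shows "20 * sumsq l + sumsq U = \<alpha> * (20 * sum f l + sum f U) + 21 * \<beta>"
proof -
  have l': "vec.subspace l" "vec.dim l = 2" "l \<subseteq> U"
    using l by (auto simp: lines_within_def)
  have card: "int (card (pencil l U)) = 21"
    using card_pencil_4[OF l'(1) U(1) l'(3)] U l' by simp
  have "(\<Sum>P\<in>pencil l U. sumsq P) = (\<Sum>P\<in>pencil l U. \<alpha> * sum f P + \<beta>)"
    using affine l' by (intro sum.cong refl) (auto simp: pencil_def)
  also have "\<dots> = \<alpha> * (\<Sum>P\<in>pencil l U. sum f P) + 21 * \<beta>"
    using card by (simp add: sum.distrib sum_distrib_left)
  finally show ?thesis
    using sum_pencil_weights[OF l'(1) U(1) l'(3) card] by simp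
qed

text \<open>A second addition, over the 85 lines of \<open>U\<close> on \<open>u\<close>, followed
  by division by 105. Thus all values of \<open>f\<close> at points of \<open>U\<close> are roots of
  one quadratic equation.\<close>

lemma affine_planes:
  assumes U: "vec.subspace U" "vec.dim U = 5" and u: "u \<in> U" "u \<noteq> 0"
    and affine: "\<And>P. vec.subspace P \<Longrightarrow> vec.dim P = 3 \<Longrightarrow> P \<subseteq> U \<Longrightarrow> sumsq P = \<alpha> * sum f P + \<beta>"
  shows "48 * (f u)\<^sup>2 + sumsq U = \<alpha> * (48 * f u + sum f U) + 17 * \<beta>"
proof -
  let ?L = "pencil (vec.span {u}) U"
  have card: "int (card ?L) = 85"
    using card_pencil_point[of U u 85] U u by simp
  have "(\<Sum>l\<in>?L. 20 * sumsq l + sumsq U) = (\<Sum>l\<in>?L. \<alpha> * (20 * sum f l + sum f U) + 21 * \<beta>)"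
    using U affine by (intro sum.cong refl planes_on_line) (auto simp: pencil_point u)
  then have "20 * (\<Sum>l\<in>?L. sumsq l) + 85 * sumsq U
      = \<alpha> * (20 * (\<Sum>l\<in>?L. sum f l) + 85 * sum f U) + 85 * (21 * \<beta>)"
    using card by (simp add: sum.distrib flip: sum_distrib_left)
  moreover have "(\<Sum>l\<in>?L. sum f l) = 252 * f u + sum f U"
    "(\<Sum>l\<in>?L. sumsq l) = 252 * (f u)\<^sup>2 + sumsq U"
    using sum_pencil_weights[of "vec.span {u}" U 85] U u card
    by (simp_all add: point_subset_iff sum_point sum_sq_point sumsq_def)
  ultimately show ?thesis
    by (simp add: algebra_simps)
qed

lemma ex_line:
  fixes U :: "('a^'n) set"
  assumes "vec.subspace U" "2 \<le> vec.dim U"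
  obtains l where "l \<in> lines_within U"
proof -
  obtain l where "vec.subspace l" "l \<subseteq> vec.span U" "vec.dim l = 2"
    using vec.choose_subspace_of_subspace assms(2) by blast
  moreover have "vec.span U = U"
    using assms(1) vec.span_eq_iff by blast
  ultimately show ?thesis
    using that by (auto simp: lines_within_def)
qed

text \<open>A line has 15 nonzero vectors and sum 0 or 12, so a residue \<open>-c\<close> modulo 4
  common to all values makes \<open>15 * c\<close> divisible by 4.\<close>

lemma constant_residue:
  assumes U: "vec.subspace U" "2 \<le> vec.dim U"
    and "\<And>v. v \<in> U \<Longrightarrow> v \<noteq> 0 \<Longrightarrow> 4 dvd f v + c"
  shows "4 dvd c"
proof -
  obtain l where l: "vec.subspace l" "vec.dim l = 2" "l \<subseteq> U"
    using ex_line[OF U] by (auto simp: lines_within_def)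
  have "card l = 16"
    using card_subspace[OF l(1)] l(2) by (simp add: card_field)
  then have "card (l - {0}) = 15"
    using vec.subspace_0[OF l(1)] by simp
  then have "(\<Sum>v\<in>l - {0}. f v + c) = sum f l + 15 * c"
    using sum_remove_zero[OF l(1), of f] by (simp add: sum.distrib)
  moreover have "4 dvd (\<Sum>v\<in>l - {0}. f v + c)"
    using assms(3) l(3) by (intro dvd_sum) auto
  moreover have "sum f l = 0 \<or> sum f l = 12"
    using line_sum[OF l(1,2)] by simp
  ultimately have "4 dvd 15 * c \<or> 4 dvd 12 + 15 * c" by auto
  then show ?thesis by presburger
qed

lemma large_weight_planes:
  assumes U: "vec.subspace U" "vec.dim U = 5"
    and "(weight U, m) \<in> set [(21, 32), (22, 33), (28, 38), (36, 42), (42, 43), (43, 43)]"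
      "42 * m = weight U * (85 - weight U)"
    and P: "vec.subspace P" "vec.dim P = 3" "P \<subseteq> U"
  shows "weight P \<in> set (if weight U \<le> 22 then [1, 2] else if weight U \<le> 36 then [0, 4]
    else if weight U = 42 then [0, 2, 3] else [2, 3])"
proof -
  obtain m' where m': "42 * m' = weight U * (85 - weight U)"
    "reachable (if weight P = 0 then (0, 11) # solid_pairs else solid_pairs) 5
      (weight U + 4 * weight P) (55 - (m' + 2 * weight P * (5 - weight P)))"
    using solids_on_plane[OF U P] by blast
  then have "m' = m" using assms(4) by simp
  then show ?thesis
    using plane_weight_cases[OF _ assms(3)] m'(2) plane_facts(3,4)[OF P(1,2)] by metis
qed

text \<open>A value other than 0 and 1 is refuted for every possible weight of the 4-space: directly
  at the small and the large weights, through the plane weights and \<open>affine_planes\<close> in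
  between.\<close>

lemma small_values_binary:
  assumes U: "vec.subspace U" "vec.dim U = 5" and u: "u \<in> U" "u \<noteq> 0"
    and bounds: "\<And>v. -2 \<le> f v \<and> f v \<le> 3"
  shows "f u = 0 \<or> f u = 1"
proof (rule ccontr)
  assume neg: "\<not> (f u = 0 \<or> f u = 1)"
  note facts = space_facts[OF U]
  let ?L = "pencil (vec.span {u}) U"
  obtain P where P: "vec.subspace P" "vec.dim P = 3" "P \<subseteq> U"
  proof -
    have "\<exists>P. vec.subspace P \<and> vec.span {u} \<subseteq> P \<and> P \<subseteq> U \<and> vec.dim P = 3"
      using U u by (intro ex_subspace_between) (auto simp: point_subset_iff)
    then show ?thesis using that by blast
  qed
  obtain m where m: "sumsq U = 24 * m" "42 * m = weight U * (85 - weight U)"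
    using solids_on_plane[OF U P] by blast
  have "\<not> weight U < 21"
  proof
    assume small: "weight U < 21"
    \<comment> \<open>\<open>weight U + 21 * f v\<close> is a degree, hence nonnegative.\<close>
    have nonneg: "0 \<le> f v" if "v \<in> U" for v
      using facts(4)[of v] small that by (cases "v = 0") auto
    \<comment> \<open>Every line on \<open>u\<close> has positive sum, so \<open>u\<close> has the
      full degree 85; with weight below 21 this needs \<open>f u\<close> \<ge> 4.\<close>
    have "sum f l = 12" if "l \<in> ?L" for l
    proof -
      have l: "vec.subspace l" "vec.dim l = 2" "l \<subseteq> U" "u \<in> l"
        using that u by (auto simp: pencil_point lines_within_def)
      have "f u \<le> sum f l"
        using l nonneg by (intro member_le_sum) auto
      then show ?thesis
        using neg nonneg[OF u(1)] line_sum[OF l(1,2)] by auto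
    qed
    then have "{l \<in> ?L. sum f l = 3 * 4} = ?L" by auto
    then have "degree u U = 85"
      using card_pencil_point[of U u 85] U u by (simp add: degree_def)
    then show False
      using facts(3)[OF u] small bounds[of u] by presburger
  qed
  moreover have "\<not> weight U \<in> {49, 57, 63}"
  proof
    assume large: "weight U \<in> {49, 57, 63}"
    \<comment> \<open>A degree is at most 85, and already 49 + 2 * 21 exceeds 85.\<close>
    have le: "f v \<le> 1" if "v \<in> U" for v
      using facts(4)[of v] large that by (cases "v = 0") auto
    then have neg': "f u \<le> -1" using neg u by force
    \<comment> \<open>The three vectors of the point \<open>u\<close> contribute at most -3 and the
      other twelve at most 12, so no line on \<open>u\<close> has sum 12. The degree is then 0, but
      no weight listed here is 21 or 42.\<close>
    have "sum f l \<noteq> 12" if "l \<in> ?L" for l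
    proof
      assume 12: "sum f l = 12"
      have l: "vec.subspace l" "vec.dim l = 2" "l \<subseteq> U" "u \<in> l"
        using that u by (auto simp: pencil_point lines_within_def)
      have point: "vec.span {u} \<subseteq> l" using l by (simp add: point_subset_iff)
      have "card (l - vec.span {u}) = 12"
        using card_subspace[OF l(1)] card_subspace[OF subspace_point, of u] l(2) u point
        by (simp add: card_field card_Diff_subset)
      then have "sum f (l - vec.span {u}) \<le> 12"
        using sum_bounded_above[of "l - vec.span {u}" f 1] le l(3) by auto
      then show False
        using sum_diff[OF finite point, of f] sum_point[OF u(2)] neg' 12 by simp
    qed
    then have "degree u U = 0" by (auto simp: degree_def)
    then have "weight U + 21 * f u = 0" using facts(3)[OF u] by linarith
    moreover have "f u = -1 \<or> f u = -2" using neg' bounds[of u] by linarith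
    ultimately show False using large by auto
  qed
  moreover have "weight U \<noteq> 64"
  proof
    assume "weight U = 64"
    then have "sumsq U = sum f U" using m facts(1) by simp
    then show False using sumsq_eq_sum u(1) neg by blast
  qed
  ultimately have cases: "(weight U, m) \<in> set [(21, 32), (22, 33), (28, 38), (36, 42), (42, 43), (43, 43)]"
    using weight_cases[OF facts(5,6) m(2)] by blast
  note planes = large_weight_planes[OF U cases m(2)]
  consider "weight U \<le> 22" | "weight U \<in> {28, 36}" | "weight U \<in> {42, 43}"
    using cases by auto
  then show False
  proof cases
    case 1
    \<comment> \<open>Plane weights 1 and 2 give sums 12, 24 and sums of squares 48, 72: slope 2,
      intercept 24.\<close>
    have quad: "48 * (f v)\<^sup>2 + sumsq U = 2 * (48 * f v + sum f U) + 17 * 24" if "v \<in> U" "v \<noteq> 0" for v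
    proof (rule affine_planes[OF U that])
      fix P :: "('a^'n) set" assume P: "vec.subspace P" "vec.dim P = 3" "P \<subseteq> U"
      then have "weight P = 1 \<or> weight P = 2" using planes[OF P] 1 by simp
      then show "sumsq P = 2 * sum f P + 24"
        using plane_facts(1,2)[OF P(1,2)] by auto
    qed
    have "weight U = 21 \<and> m = 32 \<or> weight U = 22 \<and> m = 33"
      using cases 1 by simp
    then have const: "2 * sum f U + 17 * 24 - sumsq U = 144"
      unfolding facts(1) m(1) by auto
    have eq: "(f v)\<^sup>2 - 2 * f v - 3 = 0" if "v \<in> U" "v \<noteq> 0" for v
      using quad[OF that] const by presburger
    \<comment> \<open>The roots are 3 and -1, both congruent to -1 modulo 4.\<close>
    have residue: "4 dvd f v + 1" if "v \<in> U" "v \<noteq> 0" for v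
    proof -
      have "(f v - 3) * (f v + 1) = 0"
        using eq[OF that] by (simp add: algebra_simps power2_eq_square)
      then show ?thesis by auto
    qed
    have "2 \<le> vec.dim U" using U(2) by simp
    from constant_residue[OF U(1) this residue] show False by simp
  next
    case 2
    \<comment> \<open>At plane weights 0 and 4 the sum of squares equals the sum; the resulting
      quadratic has no real root.\<close>
    have "48 * (f u)\<^sup>2 + sumsq U = 1 * (48 * f u + sum f U) + 17 * 0"
    proof (rule affine_planes[OF U u])
      fix P :: "('a^'n) set" assume P: "vec.subspace P" "vec.dim P = 3" "P \<subseteq> U"
      then have "weight P = 0 \<or> weight P = 4" using planes[OF P] 2 by auto
      then show "sumsq P = 1 * sum f P + 0"
        using plane_facts(1,2)[OF P(1,2)] by auto
    qed
    moreover have "weight U = 28 \<and> m = 38 \<or> weight U = 36 \<and> m = 42"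
      using cases 2 by auto
    then have "sumsq U - sum f U = 576"
      unfolding facts(1) m(1) by auto
    ultimately have "48 * (f u)\<^sup>2 + 576 = 48 * f u" by simp
    then show False using int_le_square[of "f u"] by linarith
  next
    case 3
    then have S: "sumsq U = 1032" using cases m(1) by auto
    \<comment> \<open>A plane of weight 0 contains a line on which \<open>f\<close> vanishes. The
      planes of \<open>U\<close> on that line have sums of squares 0 or 72, with total
      \<open>sumsq U\<close> = 1032, which is not a multiple of 72.\<close>
    have nonzero: "weight P \<noteq> 0" if P: "vec.subspace P" "vec.dim P = 3" "P \<subseteq> U" for P
    proof
      assume 0: "weight P = 0"
      obtain l where l: "l \<in> lines_within P" using ex_line[OF P(1)] P(2) by auto
      then have l': "vec.subspace l" "vec.dim l = 2" "l \<subseteq> P" by (auto simp: lines_within_def)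
      have "f v = 0" if "v \<in> l" for v
        using plane_facts(6)[OF P(1,2) 0] that l' by auto
      then have zero: "sumsq l = 0" by (simp add: sumsq_def)
      have lU: "l \<subseteq> U" using l' P by auto
      have "72 dvd sumsq X" if X: "X \<in> pencil l U" for X
      proof -
        have X: "vec.subspace X" "vec.dim X = 3" "X \<subseteq> U"
          using X l' by (auto simp: pencil_def)
        then have "weight X \<in> {0, 2, 3}" using planes[OF X] 3 by (auto split: if_splits)
        then show ?thesis using plane_facts(2)[OF X(1,2)] by auto
      qed
      then have "72 dvd (\<Sum>X\<in>pencil l U. sumsq X)" by (rule dvd_sum)
      then have "(72 :: int) dvd 1032"
        using sum_pencil_weights(2)[OF l'(1) U(1) lU refl] zero S by simp
      then show False by simp
    qed
    \<comment> \<open>Plane weights 2 and 3 share the sum of squares 72, so the relation has slope 0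
      and every value is 2 or -2.\<close>
    have eq: "48 * (f v)\<^sup>2 + sumsq U = 0 * (48 * f v + sum f U) + 17 * 72" if "v \<in> U" "v \<noteq> 0" for v
    proof (rule affine_planes[OF U that])
      fix P :: "('a^'n) set" assume P: "vec.subspace P" "vec.dim P = 3" "P \<subseteq> U"
      then have "weight P = 2 \<or> weight P = 3"
        using planes[OF P] nonzero[OF P] 3 by (auto split: if_splits)
      then show "sumsq P = 0 * sum f P + 72"
        using plane_facts(2)[OF P(1,2)] by auto
    qed
    have residue: "4 dvd f v + 2" if "v \<in> U" "v \<noteq> 0" for v
    proof -
      have "(f v - 2) * (f v + 2) = 0"
        using eq[OF that] S by (simp add: algebra_simps power2_eq_square)
      then show ?thesis by auto
    qed
    have "2 \<le> vec.dim U" using U(2) by simp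
    from constant_residue[OF U(1) this residue] show False by simp
  qed
qed

end

section \<open>Classification for line sums 0 and 4\<close>

lemma pg_lines_eq: "pg_lines = lines_within UNIV"
  by (auto simp: pg_lines_def pg_subspaces_def lines_within_def)

lemma span_point_in_pg_points: "u \<noteq> 0 \<Longrightarrow> vec.span {u} \<in> pg_points"
  by (simp add: pg_points_def pg_subspaces_def)

context four_valued
begin

text \<open>A line either lies in the zero set or has twelve vectors of value 1, hence exactly one
  point of value 0. A set of points met by lines in this way is a hyperplane or the whole
  space.\<close>

lemma zero_set_of_binary:
  assumes binary: "\<And>v. f v = 0 \<or> f v = 1"
  defines "Z \<equiv> {v. f v = 0}"
  shows "vec.subspace Z" "Z = UNIV \<or> Z \<in> pg_hyperplanes"
    and "\<And>l. l \<in> pg_lines \<Longrightarrow> sum f l = 12 \<longleftrightarrow> \<not> l \<subseteq> Z"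
proof -
  have le: "f v \<le> 1" for v using binary[of v] by auto
  have line: "sum f l = 0 \<and> l \<subseteq> Z \<or> sum f l = 12 \<and> \<not> l \<subseteq> Z"
    if "vec.subspace l" "vec.dim l = 2" for l
  proof -
    have "0 \<le> f v" for v using binary[of v] by auto
    then have "sum f l = 0 \<longleftrightarrow> l \<subseteq> Z"
      by (auto simp: sum_nonneg_eq_0_iff Z_def)
    then show ?thesis using line_sum[OF that] by auto
  qed
  show "sum f l = 12 \<longleftrightarrow> \<not> l \<subseteq> Z" if "l \<in> pg_lines" for l
    using line[of l] that by (auto simp: pg_lines_eq lines_within_def)
  have point: "vec.span {u} \<subseteq> Z" if "f u = 0" for u
  proof
    fix v assume "v \<in> vec.span {u}"
    then obtain c where "v = c *s u" by (auto simp: vec.span_singleton)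
    then show "v \<in> Z" using that f_scale[of c u] by (cases "c = 0") (auto simp: Z_def)
  qed
  have join: "vec.span (insert v (vec.span {u})) \<in> lines_within UNIV"
    "u \<in> vec.span (insert v (vec.span {u}))" "v \<in> vec.span (insert v (vec.span {u}))"
    if "u \<noteq> 0" "v \<notin> vec.span {u}" for u v :: "'a^'n"
    using span_insert_in_pencil[of "vec.span {u}" UNIV v] that
    by (auto simp: pencil_point intro: vec.span_base)
  show sub: "vec.subspace Z"
  proof (rule vec.subspaceI)
    show "0 \<in> Z" by (simp add: Z_def)
    show "c *s v \<in> Z" if "v \<in> Z" for c v
      using that f_scale[of c v] by (cases "c = 0") (auto simp: Z_def)
    show "u + v \<in> Z" if "u \<in> Z" "v \<in> Z" for u v
    proof (cases "u = 0 \<or> v \<in> vec.span {u}")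
      case True
      then have "u = 0 \<or> u + v \<in> vec.span {u}"
        by (auto intro: vec.span_add vec.span_base)
      then show ?thesis using point[of u] that by (auto simp: Z_def)
    next
      case False
      define l where "l = vec.span (insert v (vec.span {u}))"
      have l: "vec.subspace l" "vec.dim l = 2" "u \<in> l" "v \<in> l"
        using join[of u v] False by (auto simp: l_def lines_within_def)
      have "v \<noteq> 0" using False vec.span_zero[of "{u}"] by auto
      \<comment> \<open>Removing the four multiples of \<open>u\<close> and the single vector
        \<open>v\<close> already leaves only 11 < 12 vectors, so the line sum is 0.\<close>
      have "card (l - (vec.span {u} \<union> {v})) = 16 - 5"
      proof -
        have "vec.span {u} \<union> {v} \<subseteq> l"
          using l(4) point_subset_iff[OF l(1), of u] l(3) by blast
        moreover have "card (vec.span {u} \<union> {v}) = 5"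
          using card_subspace[OF subspace_point, of u] False by (simp add: card_field)
        ultimately show ?thesis
          using card_subspace[OF l(1)] l(2) by (simp add: card_field card_Diff_subset)
      qed
      then have "sum f (l - (vec.span {u} \<union> {v})) \<le> 11"
        using sum_bounded_above[of "l - (vec.span {u} \<union> {v})" f 1] le by simp
      moreover have "sum f (l - (vec.span {u} \<union> {v})) = sum f l"
        using that point[of u] by (intro sum.mono_neutral_left) (auto simp: Z_def)
      ultimately have "l \<subseteq> Z" using line[OF l(1,2)] by auto
      then show ?thesis using vec.subspace_add[OF l(1,3,4)] by auto
    qed
  qed
  show "Z = UNIV \<or> Z \<in> pg_hyperplanes"
  proof (cases "Z = UNIV")
    case False
    then obtain v where v: "v \<notin> Z" by auto
    then have v': "f v = 1" "v \<noteq> 0" using binary[of v] by (auto simp: Z_def)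
    \<comment> \<open>The line on \<open>v\<close> and \<open>w\<close> has a zero off the point
      \<open>v\<close>, as otherwise its sum would be 15. So \<open>v\<close> and \<open>Z\<close>
      together span everything.\<close>
    have "w \<in> vec.span (insert v Z)" for w
    proof (cases "w \<in> vec.span {v}")
      case True
      then show ?thesis
        using vec.span_mono[of "{v}" "insert v Z"] by auto
    next
      case w: False
      define l where "l = vec.span (insert w (vec.span {v}))"
      have l: "vec.subspace l" "vec.dim l = 2" "v \<in> l" "w \<in> l"
        using join[of v w] w v' by (auto simp: l_def lines_within_def)
      have "\<exists>z\<in>l - vec.span {v}. f z = 0"
      proof (rule ccontr)
        assume "\<not> ?thesis"
        then have one: "f z = 1" if "z \<in> l - vec.span {v}" for z
          using binary that by blast
        have pl: "vec.span {v} \<subseteq> l" using l by (simp add: point_subset_iff)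
        have "card (l - vec.span {v}) = 12"
          using card_subspace[OF l(1)] card_subspace[OF subspace_point, of v] l(2) v' pl
          by (simp add: card_field card_Diff_subset)
        then have "sum f (l - vec.span {v}) = 12"
          using one by simp
        then have "sum f l = 15"
          using sum_diff[OF finite pl, of f] sum_point[OF v'(2)] v' by simp
        then show False using line[OF l(1,2)] by auto
      qed
      then obtain z where z: "z \<in> l - vec.span {v}" "f z = 0" by blast
      have "l \<in> pencil (vec.span {v}) UNIV"
        using l v' by (simp add: pencil_point lines_within_def)
      then have "l = vec.span (insert z (vec.span {v}))"
        using z by (intro pencil_eq_span) auto
      also have "\<dots> \<subseteq> vec.span (insert v Z)"
        using z vec.span_mono[of "{v}" "insert v Z"]
        by (intro vec.span_minimal) (auto simp: Z_def intro: vec.span_base)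
      finally show ?thesis using l by auto
    qed
    then have "vec.span (insert v Z) = UNIV" by auto
    then have "vec.dim Z + 1 = CARD('n)"
      using dim_span_insert[OF sub v] vec_dim_card[where 'a = 'a and 'n = 'n] by simp
    then show ?thesis
      using sub by (auto simp: pg_hyperplanes_def pg_dim_def)
  qed simp
qed

end

section \<open>From the values of \<open>f\<close> to the line sets\<close>

definition standard_lines :: "('a::{field,finite}^'n::finite) set set \<Rightarrow> bool"
  where "standard_lines M \<longleftrightarrow> M = pg_lines \<or>
     (\<exists>H\<in>pg_hyperplanes. M = lines_in H) \<or>
     (\<exists>P\<in>pg_points. M = star P) \<or>
     (\<exists>P\<in>pg_points. \<exists>H\<in>pg_hyperplanes. \<not> P \<subseteq> H \<and> M = star P \<union> lines_in H)"

lemma mem_point_iff: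
  fixes u :: "'a::{field,finite}^'n::finite"
  assumes "v \<in> vec.span {u}" "v \<noteq> 0" "vec.subspace U"
  shows "v \<in> U \<longleftrightarrow> u \<in> U"
proof -
  obtain c where c: "v = c *s u" using assms(1) by (auto simp: vec.span_singleton)
  then have "c \<noteq> 0" using assms(2) by auto
  then have "u = inverse c *s v" using c by (simp add: vec.scale_scale)
  then show ?thesis using c vec.subspace_scale[OF assms(3)] by metis
qed

context four_valued
begin

lemma line_sum_pg: "l \<in> pg_lines \<Longrightarrow> vec.subspace l \<and> vec.dim l = 2 \<and> (sum f l = 0 \<or> sum f l = 12)"
  using line_sum[of l] by (simp add: pg_lines_eq lines_within_def)

lemma classification_star:
  assumes "CARD('n) \<ge> 3" "u \<noteq> 0" "f u \<ge> 4"
  shows "{l \<in> pg_lines. sum f l = 12} = star (vec.span {u})"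
proof -
  have "sum f l = 12 \<longleftrightarrow> vec.span {u} \<subseteq> l" if "l \<in> pg_lines" for l
  proof -
    have l: "vec.subspace l" "sum f l = 0 \<or> sum f l = 12" using line_sum_pg[OF that] by auto
    have off: "f v = 0" if "v \<notin> vec.span {u}" for v
      using value_ge_4(2)[OF assms that] .
    show ?thesis
    proof (cases "u \<in> l")
      case True
      then have "vec.span {u} \<subseteq> l" using point_subset_iff[OF l(1)] by blast
      moreover from this have "sum f l = sum f (vec.span {u})"
        using off by (intro sum.mono_neutral_right) auto
      ultimately show ?thesis
        using l(2) sum_point[OF assms(2)] assms(3) by auto
    next
      case False
      have "f v = 0" if "v \<in> l" for v
        using off[of v] mem_point_iff[of v u l] l(1) False that by (cases "v = 0") auto
      then have "sum f l = 0" by simp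
      then show ?thesis using False point_subset_iff[OF l(1), of u] by simp
    qed
  qed
  then show ?thesis by (auto simp: star_def)
qed

text \<open>Raising the value -3 at the point \<open>u\<close> to 1 gives a function
  \<open>g\<close> with values 0 and 1 and line sums still 0 or 12. Its zero set is the required
  hyperplane.\<close>

lemma classification_star_hyperplane:
  assumes "CARD('n) \<ge> 3" "u \<noteq> 0" "f u \<le> -3"
  shows "\<exists>H\<in>pg_hyperplanes. \<not> vec.span {u} \<subseteq> H \<and>
    {l \<in> pg_lines. sum f l = 12} = pg_lines - (star (vec.span {u}) \<union> lines_in H)"
proof -
  have "vec.span {u} \<noteq> UNIV"
  proof
    assume "vec.span {u} = UNIV"
    then have "vec.dim (vec.span {u}) = CARD('n)" using vec_dim_card by metis
    then show False using assms(1) dim_point[OF assms(2)] by simp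
  qed
  then obtain v where v: "v \<notin> vec.span {u}" by auto
  have u: "f u = -3" using value_le_minus_3(1)[OF assms v] .
  have off: "f v = 0 \<or> f v = 1" if "v \<notin> vec.span {u}" for v
    using value_le_minus_3(2)[OF assms that] .
  define p where "p v = (if v \<in> vec.span {u} - {0} then 4 else 0 :: int)" for v
  define g where "g v = f v + p v" for v
  have on: "f v = -3" if v: "v \<in> vec.span {u}" "v \<noteq> 0" for v
  proof -
    obtain c where "v = c *s u" using v(1) by (auto simp: vec.span_singleton)
    then show ?thesis using f_scale[of c u] v(2) u by (cases "c = 0") auto
  qed
  have g_line: "sum g l = (if u \<in> l then 12 else sum f l)" "u \<in> l \<Longrightarrow> sum f l = 0"
    if l: "vec.subspace l" "vec.dim l = 2" for l
  proof -
    have "sum p l = (if u \<in> l then 12 else 0)"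
    proof (cases "u \<in> l")
      case True
      then have sub: "vec.span {u} - {0} \<subseteq> l" using point_subset_iff[OF l(1)] by blast
      have "card (vec.span {u} - {0}) = 3"
        using card_subspace[OF subspace_point, of u] assms(2) by (simp add: card_field vec.span_zero)
      moreover have "sum p l = sum p (vec.span {u} - {0})"
        using sub by (intro sum.mono_neutral_right) (auto simp: p_def)
      ultimately show ?thesis using True by (simp add: p_def)
    next
      case False
      then have "p v = 0" if "v \<in> l" for v
        using mem_point_iff[of v u l] l(1) that by (auto simp: p_def)
      then show ?thesis using False by simp
    qed
    \<comment> \<open>The sum of \<open>f\<close> on a line through \<open>u\<close> is at most 12 -
      9, hence 0; raising three vectors by 4 turns it into 12.\<close>
    moreover show "sum f l = 0" if "u \<in> l"
    proof -
      have pl: "vec.span {u} \<subseteq> l" using that l by (simp add: point_subset_iff)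
      have "card (l - vec.span {u}) = 12"
        using card_subspace[OF l(1)] card_subspace[OF subspace_point, of u] l(2) assms(2) pl
        by (simp add: card_field card_Diff_subset)
      moreover have "f v \<le> 1" if "v \<in> l - vec.span {u}" for v
        using off[of v] that by auto
      ultimately have "sum f (l - vec.span {u}) \<le> 12"
        using sum_bounded_above[of "l - vec.span {u}" f 1] by simp
      then have "sum f l < 12"
        using sum_diff[OF finite pl, of f] sum_point[OF assms(2)] u by simp
      then show ?thesis using line_sum[OF l] by simp
    qed
    ultimately show "sum g l = (if u \<in> l then 12 else sum f l)"
      by (simp add: g_def sum.distrib)
  qed
  interpret g: four_valued g
  proof
    show "CARD('a) = 4" by (rule card_field)
    show "g 0 = 0" by (simp add: g_def p_def)
    show "g (c *s v) = g v" if "c \<noteq> 0" for c v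
    proof -
      have "c *s v \<in> vec.span {u} \<longleftrightarrow> v \<in> vec.span {u}"
        using mem_point_iff[of "c *s v" v "vec.span {u}"] that
        by (metis subspace_point vec.scale_eq_0_iff vec.span_base vec.span_scale singletonI)
      then show ?thesis using that f_scale[of c v] by (simp add: g_def p_def)
    qed
    show "sum g l = 0 \<or> sum g l = 3 * 4" if "vec.subspace l" "vec.dim l = 2" for l
      using g_line[OF that] line_sum[OF that] by simp
  qed
  have binary: "g v = 0 \<or> g v = 1" for v
    using on[of v] off[of v] by (cases "v = 0") (auto simp: g_def p_def)
  define Z where "Z = {v. g v = 0}"
  have "u \<notin> Z" using u assms(2) by (simp add: Z_def g_def p_def vec.span_base)
  have sub: "vec.subspace Z" and Z: "Z = UNIV \<or> Z \<in> pg_hyperplanes"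
    and lines: "\<And>l. l \<in> pg_lines \<Longrightarrow> sum g l = 12 \<longleftrightarrow> \<not> l \<subseteq> Z"
    using g.zero_set_of_binary[OF binary] unfolding Z_def by auto
  have "\<not> vec.span {u} \<subseteq> Z" using \<open>u \<notin> Z\<close> point_subset_iff[OF sub] by blast
  moreover have "sum f l = 12 \<longleftrightarrow> \<not> vec.span {u} \<subseteq> l \<and> \<not> l \<subseteq> Z" if "l \<in> pg_lines" for l
  proof -
    have l: "vec.subspace l" "vec.dim l = 2" using line_sum_pg[OF that] by auto
    show ?thesis
      using g_line[OF l] lines[OF that] point_subset_iff[OF l(1), of u] by (cases "u \<in> l") auto
  qed
  then have "{l \<in> pg_lines. sum f l = 12} = pg_lines - (star (vec.span {u}) \<union> lines_in Z)"
    by (auto simp: star_def lines_in_def)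
  moreover have "Z \<in> pg_hyperplanes" using Z \<open>u \<notin> Z\<close> by blast
  ultimately show ?thesis by blast
qed

text \<open>A value at least 4 gives a star, a value at most -3 the complement of a star joined with
  the lines of a hyperplane. Otherwise each point is placed in a 4-space, where its value is 0 or 1;
  this uses \<open>CARD('n) \<ge> 5\<close>.\<close>

lemma classification:
  assumes n: "CARD('n) \<ge> 5"
  shows "\<exists>M. ({l \<in> pg_lines. sum f l = 12} = M \<or> {l \<in> pg_lines. sum f l = 12} = pg_lines - M)
    \<and> standard_lines M"
proof -
  have n3: "CARD('n) \<ge> 3" using n by simp
  consider u where "u \<noteq> 0" "f u \<ge> 4" | u where "u \<noteq> 0" "f u \<le> -3"
    | "\<And>v. -2 \<le> f v \<and> f v \<le> 3"
  proof (cases "\<exists>u. f u \<ge> 4 \<or> f u \<le> -3")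
    case True
    then obtain u where "f u \<ge> 4 \<or> f u \<le> -3" by blast
    then show ?thesis using that(1,2)[of u] by (cases "u = 0") auto
  next
    case False
    have "-2 \<le> f v \<and> f v \<le> 3" for v
    proof -
      have "\<not> (f v \<ge> 4 \<or> f v \<le> -3)" using False by blast
      then show ?thesis by linarith
    qed
    then show ?thesis by (rule that(3))
  qed
  then show ?thesis
  proof cases
    case (1 u)
    have "standard_lines (star (vec.span {u}))"
      using span_point_in_pg_points[OF 1(1)] unfolding standard_lines_def by blast
    then show ?thesis
      using classification_star[OF n3 1] by (intro exI conjI disjI1)
  next
    case (2 u)
    obtain H where H: "H \<in> pg_hyperplanes" "\<not> vec.span {u} \<subseteq> H"
      and eq: "{l \<in> pg_lines. sum f l = 12} = pg_lines - (star (vec.span {u}) \<union> lines_in H)"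
      using classification_star_hyperplane[OF n3 2] by blast
    have "standard_lines (star (vec.span {u}) \<union> lines_in H)"
      using span_point_in_pg_points[OF 2(1)] H unfolding standard_lines_def by blast
    then show ?thesis
      using eq by (intro exI conjI disjI2)
  next
    case 3
    have "f u = 0 \<or> f u = 1" for u
    proof (cases "u = 0")
      case False
      have "\<exists>U. vec.subspace U \<and> vec.span {u} \<subseteq> U \<and> U \<subseteq> UNIV \<and> vec.dim U = 5"
      proof (rule ex_subspace_between[OF vec.subspace_span vec.subspace_UNIV subset_UNIV])
        show "vec.dim (vec.span {u}) \<le> 5" using dim_point[OF False] by simp
        show "5 \<le> vec.dim (UNIV :: ('a^'n) set)" unfolding vec_dim_card by (rule n)
      qed
      then obtain U where U: "vec.subspace U" "vec.dim U = 5" "vec.span {u} \<subseteq> U" by blast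
      then have "u \<in> U" using point_subset_iff[of U u] by blast
      then show ?thesis using small_values_binary[OF U(1,2) _ False 3] by blast
    qed simp
    note zero = zero_set_of_binary[OF this]
    have eq: "{l \<in> pg_lines. sum f l = 12} = pg_lines - lines_in {v. f v = 0}"
      unfolding lines_in_def using zero(3) by blast
    \<comment> \<open>If \<open>f\<close> vanishes identically, no line has sum 12, and the empty
      set is the complement of all lines.\<close>
    have "standard_lines (lines_in {v. f v = 0})"
    proof (cases "{v. f v = 0} = UNIV")
      case True
      then have "lines_in {v. f v = 0} = pg_lines" by (simp add: lines_in_def)
      then show ?thesis unfolding standard_lines_def by (rule disjI1)
    next
      case False
      then show ?thesis using zero(2) unfolding standard_lines_def by blast
    qed
    then show ?thesis
      using eq by (intro exI conjI disjI2)
  qed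
qed

end

section \<open>Integral rescaling to line sums 0 and 4\<close>

context two_valued
begin

lemma sum_degree_plane:
  assumes "vec.subspace P"
  shows "(\<Sum>u\<in>P - {0}. degree u P) = 15 * int (card {l \<in> lines_within P. sum f l = 3 * s})"
proof -
  have "(\<Sum>u\<in>P - {0}. degree u P)
      = (\<Sum>u\<in>P - {0}. \<Sum>l\<in>pencil (vec.span {u}) P. if sum f l = 3 * s then 1 else 0)"
    by (intro sum.cong refl) (simp add: degree_def sum.If_cases Int_def)
  also have "\<dots> = (\<Sum>l\<in>lines_within P. \<Sum>u\<in>l - {0}. if sum f l = 3 * s then 1 else 0)"
    by (rule sum_flags)
  also have "\<dots> = (\<Sum>l\<in>lines_within P. if sum f l = 3 * s then 15 else 0)"
  proof (rule sum.cong[OF refl])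
    fix l assume "l \<in> lines_within P"
    then have l: "vec.subspace l" "vec.dim l = 2" by (auto simp: lines_within_def)
    have "card (l - {0}) = 15"
      using card_subspace[OF l(1)] l(2) vec.subspace_0[OF l(1)] by (simp add: card_field)
    then show "(\<Sum>u\<in>l - {0}. if sum f l = 3 * s then 1 else 0) = (if sum f l = 3 * s then 15 else (0 :: int))"
      by simp
  qed
  also have "\<dots> = 15 * int (card {l \<in> lines_within P. sum f l = 3 * s})"
    by (simp add: sum.If_cases Int_def)
  finally show ?thesis .
qed

text \<open>Adding the degree identity over the 63 nonzero vectors of \<open>P\<close> determines
  \<open>sum f P\<close>; substituting back isolates \<open>f u\<close>. The factor after
  \<open>s\<close> is an integer whose residue modulo 5 is the same for all points of the
  plane.\<close>

lemma value_in_plane: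
  assumes P: "vec.subspace P" "vec.dim P = 3" and u: "u \<in> P" "u \<noteq> 0"
  shows "20 * f u = s * (5 * degree u P - int (card {l \<in> lines_within P. sum f l = 3 * s}))"
proof -
  let ?M = "int (card {l \<in> lines_within P. sum f l = 3 * s})"
  have deg: "sum f P + 12 * f v = 3 * s * degree v P" if "v \<in> P" "v \<noteq> 0" for v
    using sum_degree[of P v 5] P that by simp
  have "card (P - {0}) = 63"
    using card_subspace[OF P(1)] P(2) vec.subspace_0[OF P(1)] by (simp add: card_field)
  then have "63 * sum f P + 12 * sum f (P - {0}) = (\<Sum>v\<in>P - {0}. sum f P + 12 * f v)"
    by (simp add: sum.distrib sum_distrib_left)
  also have "\<dots> = (\<Sum>v\<in>P - {0}. 3 * s * degree v P)"
    using deg by (intro sum.cong) auto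
  also have "\<dots> = 3 * s * (15 * ?M)"
    unfolding sum_distrib_left[symmetric] sum_degree_plane[OF P(1)] ..
  finally have "75 * sum f P = 45 * (s * ?M)"
    using sum_remove_zero[OF P(1), of f] by simp
  then show ?thesis
    using deg[OF u] by (simp add: algebra_simps)
qed

text \<open>
  Rescaling so that the line sums become \<open>0\<close> and \<open>20\<close> yields integral values, all congruent to a
  constant \<open>c\<close> modulo 5. The quadratic identity in a solid, read modulo 5, leaves only
  \<open>c = 0\<close> and \<open>c = 4\<close>, and complementation exchanges these two cases.
\<close>

lemma normalisation:
  assumes n: "CARD('n) \<ge> 4" and s: "s \<noteq> 0"
  obtains g :: "'a^'n \<Rightarrow> int" where "four_valued g"
    "(\<forall>l\<in>pg_lines. sum g l = 12 \<longleftrightarrow> sum f l = 3 * s)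
      \<or> (\<forall>l\<in>pg_lines. sum g l = 12 \<longleftrightarrow> sum f l \<noteq> 3 * s)"
proof -
  have n3: "CARD('n) \<ge> 3" using n by simp
  define a where "a u = 20 * f u div s" for u
  have a: "20 * f u = s * a u" for u
  proof (cases "u = 0")
    case False
    obtain P where "vec.subspace P" "vec.dim P = 3" "u \<in> P" using ex_plane[OF n3] by metis
    then show ?thesis using value_in_plane[OF _ _ _ False, of P] s by (simp add: a_def)
  qed (simp add: a_def)
  \<comment> \<open>Any two points lie in a common plane, where both values involve the same
    \<open>M\<close>.\<close>
  have cong: "a u mod 5 = a v mod 5" if uv: "u \<noteq> 0" "v \<noteq> 0" for u v
  proof -
    obtain P where P: "vec.subspace P" "vec.dim P = 3" "u \<in> P" "v \<in> P" using ex_plane[OF n3] by metis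
    define M where "M = int (card {l \<in> lines_within P. sum f l = 3 * s})"
    have "s * a u = s * (5 * degree u P - M)" "s * a v = s * (5 * degree v P - M)"
      using value_in_plane[OF P(1,2,3) uv(1)] value_in_plane[OF P(1,2,4) uv(2)] a[of u] a[of v]
      by (simp_all add: M_def)
    then have "a u = 5 * degree u P - M" "a v = 5 * degree v P - M"
      using s by simp_all
    then show ?thesis by presburger
  qed
  have a_line: "sum a l = (if sum f l = 3 * s then 60 else 0)" if "l \<in> pg_lines" for l
  proof -
    have "s * sum a l = 20 * sum f l" by (simp add: a sum_distrib_left)
    moreover have "sum f l = 0 \<or> sum f l = 3 * s"
      using line_sum[of l] that by (simp add: pg_lines_eq lines_within_def)
    ultimately have "s * sum a l = s * (if sum f l = 3 * s then 60 else 0)" using s by auto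
    then show ?thesis using s by simp
  qed
  have a_scale: "a (k *s v) = a v" if "k \<noteq> 0" for k v
    using f_scale[OF that] by (simp add: a_def)
  have a_zero: "a 0 = 0" by (simp add: a_def)
  interpret a: two_valued a 20
    by unfold_locales
      (use card_field a_zero a_scale a_line in \<open>auto simp: pg_lines_eq lines_within_def\<close>)
  obtain X :: "('a^'n) set" where X: "vec.subspace X" "vec.dim X = 4"
  proof -
    have "\<exists>X :: ('a^'n) set. vec.subspace X \<and> vec.span {} \<subseteq> X \<and> X \<subseteq> UNIV \<and> vec.dim X = 4"
    proof (rule ex_subspace_between[OF vec.subspace_span vec.subspace_UNIV subset_UNIV])
      show "vec.dim (vec.span {} :: ('a^'n) set) \<le> 4" by simp
      show "4 \<le> vec.dim (UNIV :: ('a^'n) set)" unfolding vec_dim_card by (rule n)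
    qed
    then show ?thesis using that by blast
  qed
  obtain e where e: "e \<noteq> 0" "e \<in> X"
    using ex_nonzero[OF X(1)] X(2) by auto
  define c where "c = a e mod 5"
  define b where "b v = (if v = 0 then 0 else (a v - c) div 5)" for v
  have b: "a v = (if v = 0 then 0 else c) + 5 * b v" for v
  proof (cases "v = 0")
    case False
    then have "a v mod 5 = c" using cong[OF False e(1)] by (simp add: c_def)
    then show ?thesis using False by (simp add: b_def) presburger
  qed (simp add: b_def a_zero)
  have b_zero: "b 0 = 0" by (simp add: b_def)
  \<comment> \<open>The quadratic identity for the solid \<open>X\<close>, with 21 lines on a point,
    divided by 25 and read modulo 5; 255 counts the nonzero vectors of \<open>X\<close>.\<close>
  have "5 dvd (sum b X)\<^sup>2 + c * sum b X + 3 * c\<^sup>2 - 2 * c - 2 * sum b X"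
  proof -
    have X0: "0 \<in> X" using vec.subspace_0[OF X(1)] .
    have "card (X - {0}) = 255"
      using card_subspace[OF X(1)] X(2) X0 by (simp add: card_field)
    have 1: "sum a X = 255 * c + 5 * sum b X"
      using \<open>card (X - {0}) = 255\<close> X0
      by (simp add: b sum.distrib sum_distrib_left sum.If_cases flip: Diff_eq)
    have "(\<Sum>v\<in>X. (a v)\<^sup>2) = (\<Sum>v\<in>X. (if v = 0 then 0 else c\<^sup>2) + 10 * c * b v + 25 * (b v)\<^sup>2)"
    proof (rule sum.cong[OF refl])
      fix v assume "v \<in> X"
      show "(a v)\<^sup>2 = (if v = 0 then 0 else c\<^sup>2) + 10 * c * b v + 25 * (b v)\<^sup>2"
        unfolding b[of v] by (cases "v = 0") (simp_all add: b_zero power2_eq_square algebra_simps)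
    qed
    also have "\<dots> = 255 * c\<^sup>2 + 10 * c * sum b X + 25 * (\<Sum>v\<in>X. (b v)\<^sup>2)"
      using \<open>card (X - {0}) = 255\<close> X0
      by (simp add: sum.distrib sum_distrib_left sum.If_cases flip: Diff_eq)
    finally have 2: "(\<Sum>v\<in>X. (a v)\<^sup>2) = 255 * c\<^sup>2 + 10 * c * sum b X + 25 * (\<Sum>v\<in>X. (b v)\<^sup>2)" .
    have "(sum a X)\<^sup>2 + 60 * (\<Sum>v\<in>X. (a v)\<^sup>2) = 1260 * sum a X"
      using a.sum_quadratic[of X 21] X by simp
    then have "(sum b X)\<^sup>2 + c * sum b X + 3 * c\<^sup>2 - 2 * c - 2 * sum b X
        = 5 * (2570 * c + 50 * sum b X - 25 * c * sum b X - 642 * c\<^sup>2 - 12 * (\<Sum>v\<in>X. (b v)\<^sup>2))"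
      unfolding 1 2 by (simp add: algebra_simps power2_eq_square)
    then show ?thesis by (rule dvdI)
  qed
  \<comment> \<open>For these \<open>d\<close> the quadratic in \<open>B\<close> has no root modulo
    5, so it is enough to test residues.\<close>
  moreover have "\<not> 5 dvd B\<^sup>2 + d * B + 3 * d\<^sup>2 - 2 * d - 2 * B" if "d \<in> {1, 2, 3}" for B d :: int
  proof -
    define q r where "q = B div 5" and "r = B mod 5"
    have B: "B = 5 * q + r" by (simp add: q_def r_def)
    have "B\<^sup>2 + d * B + 3 * d\<^sup>2 - 2 * d - 2 * B
        = (r\<^sup>2 + d * r + 3 * d\<^sup>2 - 2 * d - 2 * r) + 5 * (q * (5 * q + 2 * r) + d * q - 2 * q)"
      unfolding B by (simp add: algebra_simps power2_eq_square)
    moreover have "r \<in> {0, 1, 2, 3, 4}" unfolding r_def by auto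
    then have "\<not> 5 dvd r\<^sup>2 + d * r + 3 * d\<^sup>2 - 2 * d - 2 * r"
      using that by auto
    ultimately show ?thesis by (metis dvd_add_left_iff dvd_triv_left)
  qed
  moreover have "c \<in> {0, 1, 2, 3, 4}" unfolding c_def by auto
  ultimately have c: "c = 0 \<or> c = 4" by blast
  have b_scale: "b (k *s v) = b v" if "k \<noteq> 0" for k v
    using a_scale[OF that] that by (simp add: b_def)
  have b_line: "5 * sum b l = sum a l - 15 * c" if "l \<in> pg_lines" for l
  proof -
    have l: "vec.subspace l" "vec.dim l = 2" using that by (auto simp: pg_lines_eq lines_within_def)
    have "0 \<in> l" "card (l - {0}) = 15"
      using card_subspace[OF l(1)] l(2) vec.subspace_0[OF l(1)] by (simp_all add: card_field)
    then show ?thesis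
      by (simp add: b sum.distrib sum_distrib_left sum.If_cases flip: Diff_eq)
  qed
  show ?thesis
  proof (cases "c = 0")
    case True
    have line: "sum b l = (if sum f l = 3 * s then 12 else 0)" if "l \<in> pg_lines" for l
      using b_line[OF that] a_line[OF that] True by (auto split: if_splits)
    have "four_valued b"
      by unfold_locales (use card_field b_scale line in \<open>auto simp: b_def pg_lines_eq lines_within_def\<close>)
    then show ?thesis using line by (intro that[of b]) auto
  next
    case False
    \<comment> \<open>For \<open>c\<close> = 4 the line sums 60 and 0 of \<open>a\<close> become 0
      and -12 for \<open>b\<close>; the change of sign restores 0 and 12 with the two kinds of lines
      interchanged.\<close>
    have line: "sum (\<lambda>v. - b v) l = (if sum f l = 3 * s then 0 else 12)" if "l \<in> pg_lines" for l
      using b_line[OF that] a_line[OF that] c False by (auto simp: sum_negf split: if_splits)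
    have "four_valued (\<lambda>v. - b v)"
      by unfold_locales (use card_field b_scale line in \<open>auto simp: b_def pg_lines_eq lines_within_def\<close>)
    then show ?thesis using line by (intro that[of "\<lambda>v. - b v"]) auto
  qed
qed

end

section \<open>Cameron--Liebler line classes\<close>

lemma meets_iff:
  fixes m l :: "('a::{field,finite}^'n::finite) set"
  assumes "vec.subspace m" "vec.subspace l"
  shows "meets m l \<longleftrightarrow> m \<inter> l - {0} \<noteq> {}"
proof
  assume "meets m l"
  then obtain P where P: "vec.subspace P" "vec.dim P = 1" "P \<subseteq> m" "P \<subseteq> l"
    by (auto simp: meets_def pg_points_def pg_subspaces_def)
  then obtain u where "u \<in> P" "u \<noteq> 0" using ex_nonzero[of P] by auto
  then show "m \<inter> l - {0} \<noteq> {}" using P by blast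
next
  assume "m \<inter> l - {0} \<noteq> {}"
  then obtain u where u: "u \<in> m" "u \<in> l" "u \<noteq> 0" by blast
  then have "vec.span {u} \<subseteq> m" "vec.span {u} \<subseteq> l"
    using assms by (simp_all add: point_subset_iff)
  then show "meets m l"
    using span_point_in_pg_points[OF u(3)] by (auto simp: meets_def)
qed

lemma card_line_inter:
  fixes m l :: "('a::{field,finite}^'n::finite) set"
  assumes "m \<in> pg_lines" "l \<in> pg_lines" "m \<noteq> l"
  shows "card (m \<inter> l - {0}) = (if meets m l then CARD('a) - 1 else 0)"
proof -
  have m: "vec.subspace m" "vec.dim m = 2" and l: "vec.subspace l" "vec.dim l = 2"
    using assms by (auto simp: pg_lines_eq lines_within_def)
  have sub: "vec.subspace (m \<inter> l)" using m(1) l(1) by (rule vec.subspace_inter)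
  have "\<not> vec.dim (m \<inter> l) \<ge> 2"
  proof
    assume "vec.dim (m \<inter> l) \<ge> 2"
    then have "m \<inter> l = m" "m \<inter> l = l"
      using vec.subspace_dim_equal[OF sub m(1)] vec.subspace_dim_equal[OF sub l(1)] m l by auto
    then show False using assms(3) by blast
  qed
  then have dim: "vec.dim (m \<inter> l) = 0 \<or> vec.dim (m \<inter> l) = 1" by linarith
  have card: "card (m \<inter> l - {0}) = CARD('a) ^ vec.dim (m \<inter> l) - 1"
    using card_subspace[OF sub] vec.subspace_0[OF sub] by simp
  show ?thesis
  proof (cases "meets m l")
    case True
    then have "m \<inter> l - {0} \<noteq> {}"
      using meets_iff[OF m(1) l(1)] by blast
    then have "card (m \<inter> l - {0}) \<noteq> 0" by (simp only: card_0_eq[OF finite] simp_thms)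
    then have "vec.dim (m \<inter> l) \<noteq> 0" unfolding card by (intro notI) simp
    then have "vec.dim (m \<inter> l) = 1" using dim by linarith
    then show ?thesis using card True by simp
  next
    case False
    then have "m \<inter> l - {0} = {}" using meets_iff[OF m(1) l(1)] by blast
    then show ?thesis using False by (simp only: card.empty) simp
  qed
qed

text \<open>Double counting of nonzero vectors of \<open>l\<close> against class lines on them: a
  class line meeting \<open>l\<close> in a point shares \<open>CARD('a) - 1\<close> of them, and
  \<open>l\<close> itself, if in the class, has them all.\<close>

lemma sum_lines_through:
  fixes L :: "('a::{field,finite}^'n::finite) set set"
  assumes L: "L \<subseteq> pg_lines" and l: "l \<in> pg_lines"
  shows "(\<Sum>u\<in>l - {0}. int (card {m \<in> L. u \<in> m}))
    = (int CARD('a) - 1) * int (card {m \<in> L - {l}. meets m l}) + (if l \<in> L then int (card (l - {0})) else 0)"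
proof -
  have count: "int (card {m \<in> L. u \<in> m})
      = (\<Sum>m | m \<in> L - {l} \<and> u \<in> m. 1) + (if l \<in> L then 1 else 0)" if "u \<in> l - {0}" for u
  proof -
    have "{m \<in> L. u \<in> m} = {m \<in> L - {l}. u \<in> m} \<union> (if l \<in> L then {l} else {})"
      using that by auto
    then have "card {m \<in> L. u \<in> m} = card {m \<in> L - {l}. u \<in> m} + card (if l \<in> L then {l} else {})"
      by (simp only:) (rule card_Un_disjoint, auto)
    then show ?thesis by simp
  qed
  have "(\<Sum>u\<in>l - {0}. \<Sum>m | m \<in> L - {l} \<and> u \<in> m. 1 :: int)
      = (\<Sum>m\<in>L - {l}. \<Sum>u | u \<in> l - {0} \<and> u \<in> m. 1)"
    by (rule sum.swap_restrict) auto
  also have "\<dots> = (\<Sum>m\<in>L - {l}. if meets m l then int CARD('a) - 1 else 0)"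
  proof (rule sum.cong[OF refl])
    fix m assume "m \<in> L - {l}"
    then have m: "m \<in> pg_lines" "m \<noteq> l" using L by auto
    have "{u. u \<in> l - {0} \<and> u \<in> m} = m \<inter> l - {0}" by auto
    then show "(\<Sum>u | u \<in> l - {0} \<and> u \<in> m. 1) = (if meets m l then int CARD('a) - 1 else 0)"
      using card_line_inter[OF m(1) l m(2)] by (simp add: of_nat_diff Suc_leI)
  qed
  also have "\<dots> = (int CARD('a) - 1) * int (card {m \<in> L - {l}. meets m l})"
    by (simp add: sum.If_cases Int_def)
  finally have *: "(\<Sum>u\<in>l - {0}. \<Sum>m | m \<in> L - {l} \<and> u \<in> m. 1 :: int)
      = (int CARD('a) - 1) * int (card {m \<in> L - {l}. meets m l})" .
  have "(\<Sum>u\<in>l - {0}. int (card {m \<in> L. u \<in> m}))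
      = (\<Sum>u\<in>l - {0}. (\<Sum>m | m \<in> L - {l} \<and> u \<in> m. 1) + (if l \<in> L then 1 else 0))"
    by (rule sum.cong[OF refl]) (rule count)
  also have "\<dots> = (int CARD('a) - 1) * int (card {m \<in> L - {l}. meets m l})
      + (if l \<in> L then int (card (l - {0})) else 0)"
    unfolding sum.distrib * by simp
  finally show ?thesis .
qed

text \<open>
  Since a line \<open>l\<close> of the class meets itself in five points, subtracting the parameter \<open>x\<close> from the
  number of class lines on each point leaves line sums proportional to the characteristic function.
\<close>

lemma cameron_liebler_two_valued:
  fixes L :: "('a::{field,finite}^'n::finite) set set"
  assumes q: "CARD('a) = 4" and L: "cameron_liebler L"
  obtains f :: "'a^'n \<Rightarrow> int" and s where "two_valued f s" "s > 0"
    "\<And>l. l \<in> pg_lines \<Longrightarrow> sum f l = 3 * s \<longleftrightarrow> l \<in> L"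
proof -
  \<comment> \<open>The 4 is the -1 in the definition of the class plus 5 for the points of the line
    itself.\<close>
  define s where "s = (\<Sum>i = 2..pg_dim TYPE('n) - 1. (4::int) ^ i) + 4"
  have "0 \<le> (\<Sum>i = 2..pg_dim TYPE('n) - 1. (4::int) ^ i)" by (rule sum_nonneg) simp
  then have s: "s > 0" by (simp add: s_def)
  obtain x :: int where sub: "L \<subseteq> pg_lines"
    and x: "\<And>l. l \<in> pg_lines \<Longrightarrow>
      int (card {m \<in> L - {l}. meets m l}) = 5 * x + (s - 5) * (if l \<in> L then 1 else 0)"
    using L q by (auto simp: cameron_liebler_def s_def)
  define f where "f v = (if v = 0 then 0 else int (card {m \<in> L. v \<in> m}) - x)" for v
  have line: "sum f l = (if l \<in> L then 3 * s else 0)" if l: "l \<in> pg_lines" for l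
  proof -
    have l': "vec.subspace l" "vec.dim l = 2" using l by (auto simp: pg_lines_eq lines_within_def)
    have card: "card (l - {0}) = 15"
      using card_subspace[OF l'(1)] l'(2) vec.subspace_0[OF l'(1)] by (simp add: q)
    have "sum f l = sum f (l - {0})"
      using sum_remove_zero[OF l'(1), of f] by (simp add: f_def)
    also have "\<dots> = (\<Sum>u\<in>l - {0}. int (card {m \<in> L. u \<in> m}) - x)"
      by (rule sum.cong) (auto simp: f_def)
    also have "\<dots> = 3 * (5 * x + (s - 5) * (if l \<in> L then 1 else 0)) + (if l \<in> L then 15 else 0) - 15 * x"
      unfolding sum_subtractf sum_lines_through[OF sub l] x[OF l] using card q by simp
    finally show ?thesis by (auto split: if_splits)
  qed
  have "two_valued f s"
  proof
    show "CARD('a) = 4" by (rule q)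
    show "f 0 = 0" by (simp add: f_def)
    show "f (c *s v) = f v" if "c \<noteq> 0" for c v
    proof (cases "v = 0")
      case False
      have "c *s v \<in> m \<longleftrightarrow> v \<in> m" if "m \<in> L" for m
      proof (rule mem_point_iff)
        show "c *s v \<in> vec.span {v}" by (intro vec.span_scale vec.span_base) simp
        show "c *s v \<noteq> 0" using \<open>c \<noteq> 0\<close> False by simp
        show "vec.subspace m" using that sub by (auto simp: pg_lines_eq lines_within_def)
      qed
      then have "{m \<in> L. c *s v \<in> m} = {m \<in> L. v \<in> m}" by blast
      then show ?thesis using False that by (simp add: f_def)
    qed simp
    show "sum f l = 0 \<or> sum f l = 3 * s" if "vec.subspace l" "vec.dim l = 2" for l
      using line[of l] that by (simp add: pg_lines_eq lines_within_def)
  qed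
  moreover have "sum f l = 3 * s \<longleftrightarrow> l \<in> L" if "l \<in> pg_lines" for l
    using line[OF that] s by simp
  ultimately show ?thesis using s that by blast
qed

lemma standard_lines_subset:
  fixes M :: "('a::{field,finite}^'n::finite) set set"
  assumes "standard_lines M"
  shows "M \<subseteq> pg_lines"
proof -
  have "star P \<subseteq> pg_lines" "lines_in H \<subseteq> pg_lines" for P H :: "('a^'n) set"
    by (auto simp: star_def lines_in_def)
  then show ?thesis
    using assms unfolding standard_lines_def by (elim disjE bexE conjE) simp_all
qed

theorem theorem3:
  fixes L :: "('a::{field,finite}^'n::finite) set set"
  assumes "CARD('a) = 4"
    and "pg_dim TYPE('n) \<ge> 4"
    and "cameron_liebler L"
  shows "\<exists>M. (L = M \<or> L = pg_lines - M) \<and>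
    (M = pg_lines \<or>
     (\<exists>H\<in>pg_hyperplanes. M = lines_in H) \<or>
     (\<exists>P\<in>pg_points. M = star P) \<or>
     (\<exists>P\<in>pg_points. \<exists>H\<in>pg_hyperplanes. \<not> P \<subseteq> H \<and> M = star P \<union> lines_in H))"
proof -
  have n: "CARD('n) \<ge> 5" using assms(2) by (simp add: pg_dim_def)
  have sub: "L \<subseteq> pg_lines" using assms(3) by (simp add: cameron_liebler_def)
  obtain f :: "'a^'n \<Rightarrow> int" and s where f: "two_valued f s" "s > 0"
    "\<And>l. l \<in> pg_lines \<Longrightarrow> sum f l = 3 * s \<longleftrightarrow> l \<in> L"
    using cameron_liebler_two_valued[OF assms(1,3)] by blast
  have n4: "CARD('n) \<ge> 4" and s: "s \<noteq> 0" using n f(2) by auto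
  obtain g :: "'a^'n \<Rightarrow> int" where g: "four_valued g"
    and "(\<forall>l\<in>pg_lines. sum g l = 12 \<longleftrightarrow> sum f l = 3 * s)
      \<or> (\<forall>l\<in>pg_lines. sum g l = 12 \<longleftrightarrow> sum f l \<noteq> 3 * s)"
    by (rule two_valued.normalisation[OF f(1) n4 s])
  then have g_lines: "(\<forall>l\<in>pg_lines. sum g l = 12 \<longleftrightarrow> l \<in> L) \<or> (\<forall>l\<in>pg_lines. sum g l = 12 \<longleftrightarrow> l \<notin> L)"
    using f(3) by blast
  define A where "A = {l \<in> pg_lines. sum g l = 12}"
  have L: "L = A \<or> L = pg_lines - A"
    using g_lines sub unfolding A_def by blast
  obtain M where M: "(A = M \<or> A = pg_lines - M) \<and> standard_lines M"
    using four_valued.classification[OF g n] unfolding A_def by (rule exE)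
  then have "M \<subseteq> pg_lines" using standard_lines_subset by (elim conjE)
  \<comment> \<open>One complement may come from the normalisation and another from the
    classification; two of them cancel.\<close>
  then have compl: "pg_lines - (pg_lines - M) = M" by (rule double_diff) simp
  have "L = M \<or> L = pg_lines - M"
    using conjunct1[OF M] L
  proof (elim disjE)
    assume "A = pg_lines - M" "L = pg_lines - A"
    then show ?thesis using compl by simp
  qed simp_all
  then show ?thesis
    using conjunct2[OF M] unfolding standard_lines_def by (intro exI conjI)
qed

end
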